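(* Let $d$ be a positive integer and let $$K=\{x\in\mathbb{R}^n:g_i(x)\le 0,\ i\in I,\ h_j(x)=0,\ j\in J\}$$ be nonempty, where $I,J$ are finite index sets, the $g_i$ are convex polynomial functions and the $h_j$ are affine functions on $\mathbb{R}^n$. Assume that the LICQ holds on $K$, i.e. for every $x\in K$ the gradient vectors $\nabla g_i(x)$, $i\in I(x)$, and $\nabla h_j(x)$, $j\in J$, are linearly independent, where $I(x)=\{i\in I:g_i(x)=0\}$. Then the map $\mathrm{SOL}:\mathcal{P}_d\rightrightarrows\mathbb{R}^n$, $Q\mapsto\mathrm{SOL}(K,Q)$, is finite-valued on a generic set of $\mathcal{P}_d$.
   Context: For a nonempty closed convex set $K\subset\mathbb{R}^n$ and a continuous map $F:\mathbb{R}^n\to\mathbb{R}^n$, $\mathrm{SOL}(K,F)$ denotes the set of $x\in K$ such that $\langle F(x),y-x\rangle\ge 0$ for all $y\in K$. $\mathcal{P}_d$ is the finite-dimensional vector space of polynomial maps $\mathbb{R}^n\to\mathbb{R}^n$ all of whose components have degree at most $d$, normed by the Frobenius norm of the matrix of coefficients. A set-valued map $\Psi$ is finite-valued on a set $X$ if $\Psi(x)$ is a finite (possibly empty) set for every $x\in X$. A subset of a finite-dimensional real vector space is generic if it contains a countable intersection of dense open subsets of the space. *)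

theory Defs
  imports "HOL-Analysis.Analysis" "HOL-Computational_Algebra.Polynomial"
begin

section \<open>Polynomial maps of bounded degree\<close>

text \<open>Degree means total degree: the monomial with exponents \<open>\<alpha>\<close> has degree \<open>\<Sum>k. \<alpha> k\<close>.\<close>

definition multi_indices :: "nat \<Rightarrow> ('n::finite \<Rightarrow> nat) set" where
  "multi_indices d = {\<alpha>. (\<Sum>k\<in>UNIV. \<alpha> k) \<le> d}"

definition monomial_fun :: "('n::finite \<Rightarrow> nat) \<Rightarrow> real ^ 'n \<Rightarrow> real" where
  "monomial_fun \<alpha> x = (\<Prod>k\<in>UNIV. (x $ k) ^ \<alpha> k)"

text \<open>A coefficient matrix has one row per component of the map and one column per monomial of
  degree at most \<open>d\<close>.\<close>

definition matrix_poly_map ::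
    "nat \<Rightarrow> ('n::finite \<Rightarrow> ('n \<Rightarrow> nat) \<Rightarrow> real) \<Rightarrow> real ^ 'n \<Rightarrow> real ^ 'n" where
  "matrix_poly_map d A = (\<lambda>x. \<chi> k. \<Sum>\<alpha>\<in>multi_indices d. A k \<alpha> * monomial_fun \<alpha> x)"

definition poly_maps :: "nat \<Rightarrow> (real ^ 'n::finite \<Rightarrow> real ^ 'n) set" where
  "poly_maps d = range (matrix_poly_map d)"

text \<open>Coefficient matrices are total functions, so uniqueness requires the entries outside
  \<open>multi_indices d\<close> to be zero; see \<open>ex1_coeff_matrix\<close> below.\<close>

definition is_coeff_matrix ::
    "nat \<Rightarrow> (real ^ 'n::finite \<Rightarrow> real ^ 'n) \<Rightarrow> ('n \<Rightarrow> ('n \<Rightarrow> nat) \<Rightarrow> real) \<Rightarrow> bool" where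
  "is_coeff_matrix d Q A \<longleftrightarrow>
     Q = matrix_poly_map d A \<and> (\<forall>k. \<forall>\<alpha>. \<alpha> \<notin> multi_indices d \<longrightarrow> A k \<alpha> = 0)"

definition coeff_matrix ::
    "nat \<Rightarrow> (real ^ 'n::finite \<Rightarrow> real ^ 'n) \<Rightarrow> 'n \<Rightarrow> ('n \<Rightarrow> nat) \<Rightarrow> real" where
  "coeff_matrix d Q = (THE A. is_coeff_matrix d Q A)"

definition frobenius_norm :: "nat \<Rightarrow> (real ^ 'n::finite \<Rightarrow> real ^ 'n) \<Rightarrow> real" where
  "frobenius_norm d Q = sqrt (\<Sum>k\<in>UNIV. \<Sum>\<alpha>\<in>multi_indices d. (coeff_matrix d Q k \<alpha>)\<^sup>2)"

definition poly_maps_dist ::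
    "nat \<Rightarrow> (real ^ 'n::finite \<Rightarrow> real ^ 'n) \<Rightarrow> (real ^ 'n \<Rightarrow> real ^ 'n) \<Rightarrow> real" where
  "poly_maps_dist d P Q = frobenius_norm d (\<lambda>x. P x - Q x)"

definition poly_maps_topology :: "nat \<Rightarrow> (real ^ 'n::finite \<Rightarrow> real ^ 'n) topology" where
  "poly_maps_topology d = Metric_space.mtopology (poly_maps d) (poly_maps_dist d)"

lemma finite_multi_indices: "finite (multi_indices d :: ('n::finite \<Rightarrow> nat) set)"
proof (rule finite_subset)
  show "(multi_indices d :: ('n \<Rightarrow> nat) set) \<subseteq> Pi\<^sub>E UNIV (\<lambda>_. {..d})"
  proof
    fix \<alpha> :: "'n \<Rightarrow> nat" assume "\<alpha> \<in> multi_indices d"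
    then have s: "(\<Sum>k\<in>UNIV. \<alpha> k) \<le> d" by (simp add: multi_indices_def)
    have "\<alpha> k \<le> d" for k
      using member_le_sum[of k UNIV \<alpha>] s by simp
    then show "\<alpha> \<in> Pi\<^sub>E UNIV (\<lambda>_. {..d})" by auto
  qed
qed (simp add: finite_PiE)

lemma digits_unique:
  fixes a b :: "nat \<Rightarrow> nat"
  assumes "\<And>i. a i < N" "\<And>i. b i < N" "(\<Sum>i<n. a i * N ^ i) = (\<Sum>i<n. b i * N ^ i)"
  shows "\<forall>i<n. a i = b i"
  using assms
proof (induction n arbitrary: a b)
  case 0
  then show ?case by simp
next
  case (Suc n)
  have split: "(\<Sum>i<Suc n. c i * N ^ i) = c 0 + N * (\<Sum>i<n. c (Suc i) * N ^ i)"
    for c :: "nat \<Rightarrow> nat"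
    unfolding sum.lessThan_Suc_shift by (simp add: sum_distrib_left mult_ac)
  have eq: "a 0 + N * (\<Sum>i<n. a (Suc i) * N ^ i) = b 0 + N * (\<Sum>i<n. b (Suc i) * N ^ i)"
    using Suc.prems(3) unfolding split .
  have N: "N > 0" using Suc.prems(1)[of 0] by simp
  have "a 0 = b 0"
    using arg_cong[OF eq, of "\<lambda>m. m mod N"] Suc.prems(1)[of 0] Suc.prems(2)[of 0] by simp
  moreover from this have "(\<Sum>i<n. a (Suc i) * N ^ i) = (\<Sum>i<n. b (Suc i) * N ^ i)"
    using eq N by simp
  then have "\<forall>i<n. a (Suc i) = b (Suc i)"
    using Suc.IH[of "\<lambda>i. a (Suc i)" "\<lambda>i. b (Suc i)"] Suc.prems(1,2) by blast
  ultimately show ?case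
    by (metis less_Suc_eq_0_disj)
qed

lemma monomials_independent:
  fixes c :: "('n::finite \<Rightarrow> nat) \<Rightarrow> real"
  assumes zero: "\<And>x :: real ^ 'n. (\<Sum>\<alpha>\<in>multi_indices d. c \<alpha> * monomial_fun \<alpha> x) = 0"
    and \<beta>: "\<beta> \<in> multi_indices d"
  shows "c \<beta> = 0"
proof -
  obtain e :: "'n \<Rightarrow> nat" where e: "bij_betw e UNIV {0..<card (UNIV :: 'n set)}"
    using ex_bij_betw_finite_nat[of "UNIV :: 'n set"] by auto
  define n where "n = card (UNIV :: 'n set)"
  define N where "N = Suc d"
  define code where "code \<alpha> = (\<Sum>k\<in>UNIV. \<alpha> k * N ^ e k)" for \<alpha> :: "'n \<Rightarrow> nat"
  have inj_code: "inj_on code (multi_indices d)"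
  proof (rule inj_onI)
    fix \<alpha> \<gamma> :: "'n \<Rightarrow> nat"
    assume mem: "\<alpha> \<in> multi_indices d" "\<gamma> \<in> multi_indices d" and eq: "code \<alpha> = code \<gamma>"
    have bound: "\<delta> k < N" if "\<delta> \<in> multi_indices d" for \<delta> :: "'n \<Rightarrow> nat" and k
      using that member_le_sum[of k UNIV \<delta>] by (simp add: multi_indices_def N_def)
    have reindex: "code \<delta> = (\<Sum>i<n. \<delta> (the_inv_into UNIV e i) * N ^ i)" for \<delta>
    proof -
      have "(\<Sum>k\<in>UNIV. \<delta> (the_inv_into UNIV e (e k)) * N ^ e k)
              = (\<Sum>i\<in>{0..<n}. \<delta> (the_inv_into UNIV e i) * N ^ i)"
        using sum.reindex_bij_betw[OF e, of "\<lambda>i. \<delta> (the_inv_into UNIV e i) * N ^ i"]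
        by (simp add: n_def)
      moreover have "the_inv_into UNIV e (e k) = k" for k
        using e by (simp add: bij_betw_def the_inv_into_f_f)
      ultimately show ?thesis by (simp add: code_def lessThan_atLeast0)
    qed
    have dig: "\<forall>i<n. \<alpha> (the_inv_into UNIV e i) = \<gamma> (the_inv_into UNIV e i)"
      by (rule digits_unique[where N = N]) (use mem eq bound reindex in auto)
    show "\<alpha> = \<gamma>"
    proof
      fix k
      have "e k < n" using e by (auto simp: bij_betw_def n_def)
      moreover have "the_inv_into UNIV e (e k) = k"
        using e by (simp add: bij_betw_def the_inv_into_f_f)
      ultimately show "\<alpha> k = \<gamma> k" using dig by metis
    qed
  qed
  define p where "p = (\<Sum>\<alpha>\<in>multi_indices d. monom (c \<alpha>) (code \<alpha>))"
  have mono: "monomial_fun \<alpha> (\<chi> k. t ^ (N ^ e k)) = t ^ code \<alpha>" for \<alpha> and t :: real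
    by (simp add: monomial_fun_def code_def power_sum mult.commute flip: power_mult)
  have "poly p t = 0" for t
    using zero[of "\<chi> k. t ^ (N ^ e k)"]
    unfolding mono by (simp add: p_def poly_sum poly_monom)
  then have "p = 0" using poly_all_0_iff_0 by blast
  then have "0 = coeff p (code \<beta>)" by simp
  also have "\<dots> = (\<Sum>\<alpha>\<in>multi_indices d. if \<alpha> = \<beta> then c \<alpha> else 0)"
    unfolding p_def coeff_sum
    using inj_code \<beta> by (intro sum.cong) (auto simp: inj_on_def)
  also have "\<dots> = c \<beta>" using \<beta> by (simp add: sum.delta[OF finite_multi_indices])
  finally show ?thesis by simp
qed

lemma is_coeff_matrix_unique:
  fixes Q :: "real ^ 'n::finite \<Rightarrow> real ^ 'n"
  assumes "is_coeff_matrix d Q A" "is_coeff_matrix d Q B"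
  shows "A = B"
proof (intro ext)
  fix k :: 'n and \<beta> :: "'n \<Rightarrow> nat"
  have AB: "matrix_poly_map d A x $ k = matrix_poly_map d B x $ k" for x
    using assms by (simp add: is_coeff_matrix_def)
  have zero: "(\<Sum>\<alpha>\<in>multi_indices d. (A k \<alpha> - B k \<alpha>) * monomial_fun \<alpha> x) = 0" for x
    using AB[of x] by (simp add: matrix_poly_map_def left_diff_distrib sum_subtractf)
  show "A k \<beta> = B k \<beta>"
  proof (cases "\<beta> \<in> multi_indices d")
    case True
    then show ?thesis using monomials_independent[OF zero True] by simp
  next
    case False
    then show ?thesis using assms by (simp add: is_coeff_matrix_def)
  qed
qed

lemma ex1_coeff_matrix:
  fixes Q :: "real ^ 'n::finite \<Rightarrow> real ^ 'n"
  assumes "Q \<in> poly_maps d"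
  shows "\<exists>!A. is_coeff_matrix d Q A"
proof -
  obtain A where A: "Q = matrix_poly_map d A"
    using assms by (auto simp: poly_maps_def)
  have "is_coeff_matrix d Q (\<lambda>k \<alpha>. if \<alpha> \<in> multi_indices d then A k \<alpha> else 0)"
    unfolding is_coeff_matrix_def A matrix_poly_map_def by (auto intro!: ext sum.cong)
  then show ?thesis using is_coeff_matrix_unique by blast
qed

lemma is_coeff_matrix_coeff_matrix:
  "Q \<in> poly_maps d \<Longrightarrow> is_coeff_matrix d Q (coeff_matrix d Q)"
  unfolding coeff_matrix_def using ex1_coeff_matrix by (rule theI')

lemma coeff_matrix_eqI: "is_coeff_matrix d Q A \<Longrightarrow> coeff_matrix d Q = A"
  unfolding coeff_matrix_def using is_coeff_matrix_unique by blast

lemma is_coeff_matrix_diff: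
  assumes "is_coeff_matrix d P A" "is_coeff_matrix d Q B"
  shows "is_coeff_matrix d (\<lambda>x. P x - Q x) (\<lambda>k \<alpha>. A k \<alpha> - B k \<alpha>)"
  using assms
  by (auto simp: is_coeff_matrix_def matrix_poly_map_def vec_eq_iff left_diff_distrib sum_subtractf
      intro!: ext)

lemma coeff_matrix_diff:
  assumes "P \<in> poly_maps d" "Q \<in> poly_maps d"
  shows "coeff_matrix d (\<lambda>x. P x - Q x)
           = (\<lambda>k \<alpha>. coeff_matrix d P k \<alpha> - coeff_matrix d Q k \<alpha>)"
  using assms by (intro coeff_matrix_eqI is_coeff_matrix_diff is_coeff_matrix_coeff_matrix)

lemma frobenius_norm_L2_set:
  "frobenius_norm d Q = L2_set (\<lambda>(k, \<alpha>). coeff_matrix d Q k \<alpha>) (UNIV \<times> multi_indices d)"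
  by (simp add: frobenius_norm_def L2_set_def sum.cartesian_product case_prod_beta)

lemma poly_maps_dist_eq:
  assumes "P \<in> poly_maps d" "Q \<in> poly_maps d"
  shows "poly_maps_dist d P Q =
    L2_set (\<lambda>(k, \<alpha>). coeff_matrix d P k \<alpha> - coeff_matrix d Q k \<alpha>) (UNIV \<times> multi_indices d)"
  unfolding poly_maps_dist_def frobenius_norm_L2_set coeff_matrix_diff[OF assms] ..

lemma poly_maps_dist_commute:
  fixes P Q :: "real ^ 'n::finite \<Rightarrow> real ^ 'n"
  shows "poly_maps_dist d P Q = poly_maps_dist d Q P"
proof -
  have neg: "is_coeff_matrix d (\<lambda>x. R x - S x) (\<lambda>k \<alpha>. - A k \<alpha>)"
    if "is_coeff_matrix d (\<lambda>x. S x - R x) A" for R S :: "real ^ 'n \<Rightarrow> real ^ 'n" and A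
  proof -
    have "R x - S x = - matrix_poly_map d A x" for x
      using that by (metis is_coeff_matrix_def minus_diff_eq)
    then show ?thesis
      using that by (auto simp: is_coeff_matrix_def matrix_poly_map_def vec_eq_iff sum_negf intro!: ext)
  qed
  show ?thesis
  proof (cases "\<exists>A. is_coeff_matrix d (\<lambda>x. P x - Q x) A")
    case True
    then obtain A where A: "is_coeff_matrix d (\<lambda>x. P x - Q x) A" ..
    show ?thesis
      unfolding poly_maps_dist_def frobenius_norm_def
        coeff_matrix_eqI[OF A] coeff_matrix_eqI[OF neg[OF A]] by simp
  next
    case False
    then have "is_coeff_matrix d (\<lambda>x. P x - Q x) = is_coeff_matrix d (\<lambda>x. Q x - P x)"
      using neg by blast
    then show ?thesis
      unfolding poly_maps_dist_def frobenius_norm_def coeff_matrix_def by simp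
  qed
qed

lemma Metric_space_poly_maps:
  "Metric_space (poly_maps d :: (real ^ 'n::finite \<Rightarrow> real ^ 'n) set) (poly_maps_dist d)"
proof
  fix P Q R :: "real ^ 'n \<Rightarrow> real ^ 'n"
  let ?I = "UNIV \<times> multi_indices d :: ('n \<times> ('n \<Rightarrow> nat)) set"
  show "0 \<le> poly_maps_dist d P Q"
    by (simp add: poly_maps_dist_def frobenius_norm_L2_set)
  show "poly_maps_dist d P Q = poly_maps_dist d Q P"
    by (rule poly_maps_dist_commute)
  {
    assume P: "P \<in> poly_maps d" and Q: "Q \<in> poly_maps d"
    note cP = is_coeff_matrix_coeff_matrix[OF P] and cQ = is_coeff_matrix_coeff_matrix[OF Q]
    show "poly_maps_dist d P Q = 0 \<longleftrightarrow> P = Q"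
    proof
      assume "poly_maps_dist d P Q = 0"
      then have "coeff_matrix d P k \<alpha> = coeff_matrix d Q k \<alpha>" if "\<alpha> \<in> multi_indices d" for k \<alpha>
        using that unfolding poly_maps_dist_eq[OF P Q]
        by (auto simp: L2_set_eq_0_iff finite_multi_indices)
      then have "matrix_poly_map d (coeff_matrix d P) = matrix_poly_map d (coeff_matrix d Q)"
        by (simp add: matrix_poly_map_def cong: sum.cong)
      then show "P = Q" using cP cQ by (simp add: is_coeff_matrix_def)
    qed (simp add: poly_maps_dist_eq[OF Q Q] L2_set_eq_0_iff finite_multi_indices)
    assume R: "R \<in> poly_maps d"
    show "poly_maps_dist d P R \<le> poly_maps_dist d P Q + poly_maps_dist d Q R"
      unfolding poly_maps_dist_eq[OF P Q] poly_maps_dist_eq[OF Q R] poly_maps_dist_eq[OF P R]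
      using L2_set_triangle_ineq[of
          "\<lambda>(k, \<alpha>). coeff_matrix d P k \<alpha> - coeff_matrix d Q k \<alpha>"
          "\<lambda>(k, \<alpha>). coeff_matrix d Q k \<alpha> - coeff_matrix d R k \<alpha>" ?I]
      by (simp add: case_prod_unfold)
  }
qed

lemma topspace_poly_maps_topology [simp]: "topspace (poly_maps_topology d) = poly_maps d"
  by (simp add: poly_maps_topology_def Metric_space.topspace_mtopology[OF Metric_space_poly_maps])


section \<open>Genericity and variational inequalities\<close>

definition generic_in :: "'a topology \<Rightarrow> 'a set \<Rightarrow> bool" where
  "generic_in X S \<longleftrightarrow> S \<subseteq> topspace X \<and>
     (\<exists>U :: nat \<Rightarrow> 'a set.
        (\<forall>m. openin X (U m) \<and> X closure_of U m = topspace X) \<and> (\<Inter>m. U m) \<subseteq> S)"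

definition finite_valued_on :: "('a \<Rightarrow> 'b set) \<Rightarrow> 'a set \<Rightarrow> bool" where
  "finite_valued_on \<Psi> X \<longleftrightarrow> (\<forall>x\<in>X. finite (\<Psi> x))"

definition SOL :: "'a::real_inner set \<Rightarrow> ('a \<Rightarrow> 'a) \<Rightarrow> 'a set" where
  "SOL K F = {x \<in> K. \<forall>y\<in>K. F x \<bullet> (y - x) \<ge> 0}"


section \<open>Constraint sets and the LICQ\<close>

definition affine_function :: "('a::real_inner \<Rightarrow> real) \<Rightarrow> bool" where
  "affine_function h \<longleftrightarrow> (\<exists>a b. \<forall>x. h x = a \<bullet> x + b)"

definition feasible_set ::
    "'i set \<Rightarrow> ('i \<Rightarrow> 'a \<Rightarrow> real) \<Rightarrow> 'j set \<Rightarrow> ('j \<Rightarrow> 'a \<Rightarrow> real) \<Rightarrow> 'a set" where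
  "feasible_set I g J h = {x. (\<forall>i\<in>I. g i x \<le> 0) \<and> (\<forall>j\<in>J. h j x = 0)}"

definition gradient :: "('a::real_inner \<Rightarrow> real) \<Rightarrow> 'a \<Rightarrow> 'a" where
  "gradient f x = (THE D. GDERIV f x :> D)"

definition active_set :: "'i set \<Rightarrow> ('i \<Rightarrow> 'a \<Rightarrow> real) \<Rightarrow> 'a \<Rightarrow> 'i set" where
  "active_set I g x = {i \<in> I. g i x = 0}"

text \<open>\<open>independent\<close> speaks about sets of vectors; for an indexed family, a vector occurring
  under two different indices is a dependency.\<close>

definition independent_family :: "('k \<Rightarrow> 'a::real_vector) \<Rightarrow> 'k set \<Rightarrow> bool" where
  "independent_family v A \<longleftrightarrow> inj_on v A \<and> independent (v ` A)"

definition LICQ_on ::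
    "'a::real_inner set \<Rightarrow> 'i set \<Rightarrow> ('i \<Rightarrow> 'a \<Rightarrow> real) \<Rightarrow> 'j set \<Rightarrow> ('j \<Rightarrow> 'a \<Rightarrow> real) \<Rightarrow> bool" where
  "LICQ_on K I g J h \<longleftrightarrow>
     (\<forall>x\<in>K. independent_family
        (case_sum (\<lambda>i. gradient (g i) x) (\<lambda>j. gradient (h j) x)) (active_set I g x <+> J))"

end

theory Submission
  imports Defs
begin

text \<open>Fix a set \<open>A\<close> of inequality constraints, and let \<open>f l\<close>, \<open>l \<in> L\<close>, be these constraint functions
  together with the affine ones. A solution \<open>x\<close> with active set \<open>A\<close> satisfies \<open>f l x = 0\<close> for all
  \<open>l \<in> L\<close>, and by LICQ there are multipliers \<open>\<mu>\<close> with
  \<open>Q x = (\<Sum>l\<in>L. \<mu> l *\<^sub>R gradient (f l) x)\<close> (\<open>SOL_stationary\<close>). These are as many equations as unknowns,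
  so finitely many \<open>x\<close> are to be expected. The proof makes this precise by algebra instead of Sard's
  theorem and bounds for the number of zeros: for every coordinate \<open>q\<close> it provides a nonzero polynomial
  \<open>P\<close>, depending on the constraints, \<open>q\<close> and \<open>d\<close> but not on \<open>Q\<close>, such that \<open>P (x $ q, coefficients of Q) = 0\<close>
  for all such \<open>x\<close> and \<open>Q\<close>. If one of the coefficients of \<open>P\<close> with respect to its first argument does
  not vanish at the coefficients of \<open>Q\<close>, then only finitely many values of \<open>x $ q\<close> are possible. This
  condition on \<open>Q\<close> excludes the zero set of a nonzero polynomial, so it defines an open dense set, and
  the intersection of these sets over the finitely many \<open>A\<close> and \<open>q\<close> is the generic set.

  To find \<open>P\<close>, drop the conditions \<open>f l x = 0\<close> first. The point \<open>x\<close>, the multipliers and the nonconstant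
  coefficients of \<open>Q\<close> are then free, and they determine the constant coefficients. Counting monomials
  shows that more polynomials than variables are algebraically dependent
  (\<open>polynomials_alg_dependent\<close>), and this applies to the coordinate \<open>x $ q\<close>, the values \<open>f l x\<close> and all
  coefficients of \<open>Q\<close>. It remains to put the values \<open>f l x\<close> to zero one after the other without
  trivializing the relation: divide it by the highest power of \<open>f l x\<close> that it contains, and then put
  \<open>f l x = 0\<close> (\<open>alg_dependent_on_zero_set\<close>). The divided relation extends from the points with
  \<open>f l x \<noteq> 0\<close> to those with \<open>f l x = 0\<close> by continuity. This is where LICQ enters a second time:
  by the inverse function theorem, functions with independent gradients are part of a local
  coordinate system, so \<open>f l\<close> can be made nonzero near a given point while the other constraint functions
  keep their values (\<open>independent_gradients_vary_separately\<close>).\<close>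

section \<open>Algebraic relations between functions\<close>

text \<open>A polynomial in the variables \<open>V\<close> is given by a set \<open>C\<close> of exponents and coefficients \<open>c\<close>.
  Only the restriction of an exponent to \<open>V\<close> matters for the value; requiring that these
  restrictions differ makes distinct elements of \<open>C\<close> distinct monomials. With this convention the
  same exponents can be read again over a smaller set of variables.\<close>

definition nonzero_polynomial ::
    "'v set \<Rightarrow> ('v \<Rightarrow> nat) set \<Rightarrow> (('v \<Rightarrow> nat) \<Rightarrow> real) \<Rightarrow> bool" where
  "nonzero_polynomial V C c \<longleftrightarrow>
     finite C \<and> C \<noteq> {} \<and> inj_on (\<lambda>\<alpha>. restrict \<alpha> V) C \<and> (\<forall>\<alpha>\<in>C. c \<alpha> \<noteq> 0)"

definition polynomial_value ::
    "'v set \<Rightarrow> ('v \<Rightarrow> nat) set \<Rightarrow> (('v \<Rightarrow> nat) \<Rightarrow> real) \<Rightarrow> ('v \<Rightarrow> real) \<Rightarrow> real" where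
  "polynomial_value V C c y = (\<Sum>\<alpha>\<in>C. c \<alpha> * (\<Prod>v\<in>V. y v ^ \<alpha> v))"

definition alg_dependent_on :: "'v set \<Rightarrow> ('v \<Rightarrow> 'z \<Rightarrow> real) \<Rightarrow> 'z set \<Rightarrow> bool" where
  "alg_dependent_on V F S \<longleftrightarrow>
     (\<exists>C c. nonzero_polynomial V C c \<and> (\<forall>z\<in>S. polynomial_value V C c (\<lambda>v. F v z) = 0))"

lemma polynomial_value_cong:
  "(\<And>v. v \<in> V \<Longrightarrow> y v = y' v) \<Longrightarrow> polynomial_value V C c y = polynomial_value V C c y'"
  by (simp add: polynomial_value_def cong: prod.cong)

text \<open>Collecting the powers of one variable \<open>w\<close>: the exponents that agree at \<open>w\<close> form the
  coefficient of a power of \<open>w\<close>, and this coefficient is again a nonzero polynomial.\<close>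

lemma nonzero_polynomial_coeff:
  assumes "nonzero_polynomial (insert w V) C c" "\<alpha>0 \<in> C"
  shows "nonzero_polynomial V {\<alpha>\<in>C. \<alpha> w = \<alpha>0 w} c"
proof -
  have "inj_on (\<lambda>\<alpha>. restrict \<alpha> V) {\<alpha>\<in>C. \<alpha> w = \<alpha>0 w}"
  proof (rule inj_onI)
    fix \<alpha> \<beta>
    assume mem: "\<alpha> \<in> {\<alpha>\<in>C. \<alpha> w = \<alpha>0 w}" "\<beta> \<in> {\<alpha>\<in>C. \<alpha> w = \<alpha>0 w}"
      and eq: "restrict \<alpha> V = restrict \<beta> V"
    have "\<alpha> v = \<beta> v" if "v \<in> V" for v using that fun_cong[OF eq, of v] by simp
    then have "restrict \<alpha> (insert w V) = restrict \<beta> (insert w V)"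
      using mem by (auto simp: restrict_def fun_eq_iff)
    then show "\<alpha> = \<beta>"
      using assms(1) mem by (auto simp: nonzero_polynomial_def dest: inj_onD)
  qed
  then show ?thesis using assms by (auto simp: nonzero_polynomial_def)
qed

definition univariate :: "'v \<Rightarrow> 'v set \<Rightarrow> ('v \<Rightarrow> nat) set \<Rightarrow> (('v \<Rightarrow> nat) \<Rightarrow> real) \<Rightarrow>
    ('v \<Rightarrow> real) \<Rightarrow> real poly" where
  "univariate w V C c y = (\<Sum>\<alpha>\<in>C. monom (c \<alpha> * (\<Prod>v\<in>V. y v ^ \<alpha> v)) (\<alpha> w))"

lemma poly_univariate:
  assumes "finite V" "w \<notin> V"
  shows "poly (univariate w V C c y) t = polynomial_value (insert w V) C c (y(w := t))"
proof -
  have "(\<Prod>v\<in>V. (y(w := t)) v ^ \<alpha> v) = (\<Prod>v\<in>V. y v ^ \<alpha> v)" for \<alpha>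
    using assms by (intro prod.cong) auto
  then show ?thesis
    using assms
    by (simp add: univariate_def polynomial_value_def poly_sum poly_monom mult_ac)
qed

lemma coeff_univariate:
  assumes "finite C"
  shows "coeff (univariate w V C c y) e = polynomial_value V {\<alpha>\<in>C. \<alpha> w = e} c y"
  unfolding univariate_def polynomial_value_def coeff_sum
  using assms by (simp add: sum.inter_filter coeff_monom)

text \<open>The induction is over the variables: choose all variables but \<open>w\<close> such that some coefficient
  of a power of \<open>w\<close> does not vanish, and avoid the finitely many roots of the resulting univariate
  polynomial.\<close>

lemma nonzero_polynomial_nonzero_nearby:
  assumes "finite V" "nonzero_polynomial V C c" "\<epsilon> > 0"
  shows "\<exists>y'. (\<forall>v\<in>V. \<bar>y' v - y v\<bar> < \<epsilon>) \<and> polynomial_value V C c y' \<noteq> 0"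
  using assms
proof (induction V arbitrary: C rule: finite_induct)
  case empty
  then obtain \<alpha>0 where "\<alpha>0 \<in> C" "c \<alpha>0 \<noteq> 0" by (auto simp: nonzero_polynomial_def)
  moreover have "inj_on (\<lambda>\<alpha>. restrict \<alpha> {}) C"
    using empty by (simp add: nonzero_polynomial_def)
  then have "\<beta> = \<alpha>0" if "\<beta> \<in> C" for \<beta>
    using \<open>\<alpha>0 \<in> C\<close> that unfolding inj_on_def by (simp add: restrict_def)
  ultimately have "C = {\<alpha>0}" by blast
  then show ?case using \<open>c \<alpha>0 \<noteq> 0\<close> by (simp add: polynomial_value_def)
next
  case (insert w V)
  then obtain \<alpha>0 where \<alpha>0: "\<alpha>0 \<in> C" by (auto simp: nonzero_polynomial_def)
  have fin: "finite C" using insert.prems by (auto simp: nonzero_polynomial_def)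
  obtain y' where y': "\<forall>v\<in>V. \<bar>y' v - y v\<bar> < \<epsilon>"
      "polynomial_value V {\<alpha>\<in>C. \<alpha> w = \<alpha>0 w} c y' \<noteq> 0"
    using insert.IH[OF nonzero_polynomial_coeff[OF insert.prems(1) \<alpha>0]] insert.prems by blast
  define p where "p = univariate w V C c y'"
  have "coeff p (\<alpha>0 w) \<noteq> 0" using y' by (simp add: p_def coeff_univariate fin)
  then have "finite {t. poly p t = 0}" by (intro poly_roots_finite) auto
  moreover have "infinite {y w - \<epsilon><..<y w + \<epsilon>}" using insert.prems by simp
  ultimately obtain t where t: "t \<in> {y w - \<epsilon><..<y w + \<epsilon>}" "poly p t \<noteq> 0"
    by (metis (mono_tags, lifting) finite_subset mem_Collect_eq subsetI)
  have "polynomial_value (insert w V) C c (y'(w := t)) \<noteq> 0"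
    using t insert.hyps by (simp add: p_def poly_univariate)
  moreover have "\<forall>v\<in>insert w V. \<bar>(y'(w := t)) v - y v\<bar> < \<epsilon>"
    using t y' by (auto simp: abs_less_iff)
  ultimately show ?case by blast
qed

text \<open>A relation between the functions \<open>F v\<close> restricts to the zero set of \<open>F w\<close>: divide it by
  the highest possible power of \<open>F w\<close>, and then put \<open>F w = 0\<close>. Dividing is harmless if the points
  with \<open>F w \<noteq> 0\<close> are dense, in the sense that every zero of \<open>F w\<close> is approximated by such points as
  far as the values of the functions are concerned. The division ensures that the remaining relation
  is nontrivial.\<close>

lemma alg_dependent_on_zero_set:
  assumes V: "finite V" "w \<notin> V"
    and dep: "alg_dependent_on (insert w V) F S"
    and approx: "\<And>z. z \<in> S \<Longrightarrow> F w z = 0 \<Longrightarrow>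
      \<exists>s :: nat \<Rightarrow> 'z. (\<forall>n. s n \<in> S \<and> F w (s n) \<noteq> 0) \<and>
        (\<forall>v\<in>insert w V. (\<lambda>n. F v (s n)) \<longlonglongrightarrow> F v z)"
  shows "alg_dependent_on V F {z\<in>S. F w z = 0}"
proof -
  obtain C c where C: "nonzero_polynomial (insert w V) C c"
    and zero: "\<And>z. z \<in> S \<Longrightarrow> polynomial_value (insert w V) C c (\<lambda>v. F v z) = 0"
    using dep by (auto simp: alg_dependent_on_def)
  have fin: "finite C" and ne: "C \<noteq> {}" using C by (auto simp: nonzero_polynomial_def)
  define m where "m = Min ((\<lambda>\<alpha>. \<alpha> w) ` C)"
  have m_le: "m \<le> \<alpha> w" if "\<alpha> \<in> C" for \<alpha> using that fin by (simp add: m_def)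
  obtain \<alpha>0 where \<alpha>0: "\<alpha>0 \<in> C" "\<alpha>0 w = m"
  proof -
    have "m \<in> (\<lambda>\<alpha>. \<alpha> w) ` C" unfolding m_def using fin ne by (intro Min_in) auto
    then show thesis using that by auto
  qed
  define R where "R y = (\<Sum>\<alpha>\<in>C. c \<alpha> * (y w ^ (\<alpha> w - m) * (\<Prod>v\<in>V. y v ^ \<alpha> v)))"
    for y :: "'a \<Rightarrow> real"
  have factor: "polynomial_value (insert w V) C c y = y w ^ m * R y" for y
    unfolding polynomial_value_def R_def sum_distrib_left
    using V m_le by (intro sum.cong) (auto simp: mult_ac simp flip: power_add)
  have R0: "R y = polynomial_value V {\<alpha>\<in>C. \<alpha> w = m} c y" if "y w = 0" for y
    unfolding R_def polynomial_value_def sum.inter_filter[OF fin]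
    by (rule sum.cong) (use that m_le in \<open>auto simp: power_0_left le_antisym\<close>)
  have "polynomial_value V {\<alpha>\<in>C. \<alpha> w = m} c (\<lambda>v. F v z) = 0" if z: "z \<in> S" "F w z = 0" for z
  proof -
    obtain s where s: "\<And>n. s n \<in> S" "\<And>n. F w (s n) \<noteq> 0"
      and lim: "\<And>v. v \<in> insert w V \<Longrightarrow> (\<lambda>n. F v (s n)) \<longlonglongrightarrow> F v z"
      using approx[OF z] by blast
    have "R (\<lambda>v. F v (s n)) = 0" for n
      using zero[OF s(1)[of n]] s(2)[of n] by (simp add: factor)
    moreover have "(\<lambda>n. R (\<lambda>v. F v (s n))) \<longlonglongrightarrow> R (\<lambda>v. F v z)"
      unfolding R_def by (intro tendsto_intros lim) auto
    ultimately have "R (\<lambda>v. F v z) = 0" by (simp add: LIMSEQ_const_iff)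
    then show ?thesis using R0[of "\<lambda>v. F v z"] z by simp
  qed
  moreover have "nonzero_polynomial V {\<alpha>\<in>C. \<alpha> w = m} c"
    using nonzero_polynomial_coeff[OF C \<alpha>0(1)] \<alpha>0(2) by simp
  ultimately show ?thesis unfolding alg_dependent_on_def by blast
qed

section \<open>More polynomials than variables are algebraically dependent\<close>

lemma underdetermined_system_nontrivial_solution:
  fixes a :: "'e \<Rightarrow> 'b \<Rightarrow> real"
  assumes "finite B" "finite E" "card B < card E"
  shows "\<exists>c. (\<exists>\<alpha>\<in>E. c \<alpha> \<noteq> 0) \<and> (\<forall>\<beta>\<in>B. (\<Sum>\<alpha>\<in>E. c \<alpha> * a \<alpha> \<beta>) = 0)"
  using assms
proof (induction B arbitrary: E a rule: finite_induct)
  case empty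
  then have "E \<noteq> {}" by auto
  then show ?case by (intro exI[of _ "\<lambda>_. 1"]) auto
next
  case (insert b B)
  show ?case
  proof (cases "\<forall>\<alpha>\<in>E. a \<alpha> b = 0")
    case True
    moreover obtain c where "\<exists>\<alpha>\<in>E. c \<alpha> \<noteq> 0" "\<forall>\<beta>\<in>B. (\<Sum>\<alpha>\<in>E. c \<alpha> * a \<alpha> \<beta>) = 0"
      using insert.IH[of E a] insert.hyps insert.prems by force
    ultimately show ?thesis by auto
  next
    case False
    then obtain \<alpha>0 where \<alpha>0: "\<alpha>0 \<in> E" "a \<alpha>0 b \<noteq> 0" by auto
    define E' where "E' = E - {\<alpha>0}"
    define a' where "a' \<alpha> \<beta> = a \<alpha> \<beta> - a \<alpha> b / a \<alpha>0 b * a \<alpha>0 \<beta>" for \<alpha> \<beta>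
    have E': "finite E'" "card B < card E'" "E = insert \<alpha>0 E'" "\<alpha>0 \<notin> E'"
      using insert \<alpha>0 by (auto simp: E'_def)
    obtain c' where c': "\<exists>\<alpha>\<in>E'. c' \<alpha> \<noteq> 0" "\<forall>\<beta>\<in>B. (\<Sum>\<alpha>\<in>E'. c' \<alpha> * a' \<alpha> \<beta>) = 0"
      using insert.IH[OF E'(1,2), of a'] by blast
    define c0 where "c0 = - (\<Sum>\<alpha>\<in>E'. c' \<alpha> * a \<alpha> b) / a \<alpha>0 b"
    have sum: "(\<Sum>\<alpha>\<in>E. (c'(\<alpha>0 := c0)) \<alpha> * a \<alpha> \<beta>) = c0 * a \<alpha>0 \<beta> + (\<Sum>\<alpha>\<in>E'. c' \<alpha> * a \<alpha> \<beta>)" for \<beta>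
    proof -
      have "(\<Sum>\<alpha>\<in>E'. (c'(\<alpha>0 := c0)) \<alpha> * a \<alpha> \<beta>) = (\<Sum>\<alpha>\<in>E'. c' \<alpha> * a \<alpha> \<beta>)"
        using E'(4) by (intro sum.cong) auto
      then show ?thesis using E' by simp
    qed
    have "(\<Sum>\<alpha>\<in>E. (c'(\<alpha>0 := c0)) \<alpha> * a \<alpha> \<beta>) = (\<Sum>\<alpha>\<in>E'. c' \<alpha> * a' \<alpha> \<beta>)" for \<beta>
      unfolding sum unfolding a'_def c0_def
      by (simp add: algebra_simps sum_subtractf sum_distrib_left sum_distrib_right
          sum_divide_distrib)
    moreover have "(\<Sum>\<alpha>\<in>E'. c' \<alpha> * a' \<alpha> b) = 0" using \<alpha>0 by (simp add: a'_def)
    moreover have "\<exists>\<alpha>\<in>E. (c'(\<alpha>0 := c0)) \<alpha> \<noteq> 0" using c'(1) E' by auto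
    ultimately show ?thesis using c'(2) by (intro exI[of _ "c'(\<alpha>0 := c0)"]) auto
  qed
qed

text \<open>The degree is bounded in every coordinate separately, because the number of monomials is
  then a power.\<close>

definition coord_polynomial ::
    "'m set \<Rightarrow> ('m \<Rightarrow> 'z \<Rightarrow> real) \<Rightarrow> nat \<Rightarrow> ('z \<Rightarrow> real) \<Rightarrow> bool" where
  "coord_polynomial M X D f \<longleftrightarrow>
     (\<exists>a. \<forall>z. f z = (\<Sum>\<beta>\<in>M \<rightarrow>\<^sub>E {..D}. a \<beta> * (\<Prod>m\<in>M. X m z ^ \<beta> m)))"

lemma coord_polynomial_monomial:
  assumes "finite M" "\<And>m. m \<in> M \<Longrightarrow> \<beta> m \<le> D"
  shows "coord_polynomial M X D (\<lambda>z. c * (\<Prod>m\<in>M. X m z ^ \<beta> m))"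
proof -
  have mem: "restrict \<beta> M \<in> M \<rightarrow>\<^sub>E {..D}" using assms by auto
  have fin: "finite (M \<rightarrow>\<^sub>E {..D})" using assms by (simp add: finite_PiE)
  have "(\<Sum>\<gamma>\<in>M \<rightarrow>\<^sub>E {..D}. (if \<gamma> = restrict \<beta> M then c else 0) * (\<Prod>m\<in>M. X m z ^ \<gamma> m))
      = (\<Sum>\<gamma>\<in>M \<rightarrow>\<^sub>E {..D}. if \<gamma> = restrict \<beta> M then c * (\<Prod>m\<in>M. X m z ^ \<beta> m) else 0)" for z
    by (intro sum.cong) auto
  then have eq: "(\<Sum>\<gamma>\<in>M \<rightarrow>\<^sub>E {..D}. (if \<gamma> = restrict \<beta> M then c else 0) * (\<Prod>m\<in>M. X m z ^ \<gamma> m))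
      = c * (\<Prod>m\<in>M. X m z ^ \<beta> m)" for z
    by (subst (asm) sum.delta[OF fin]) (simp only: mem if_True)
  show ?thesis
    unfolding coord_polynomial_def
    by (rule exI[of _ "\<lambda>\<gamma>. if \<gamma> = restrict \<beta> M then c else 0"], intro allI) (simp only: eq)
qed

lemma coord_polynomial_add:
  "coord_polynomial M X D f \<Longrightarrow> coord_polynomial M X D g \<Longrightarrow>
    coord_polynomial M X D (\<lambda>z. f z + g z)"
  unfolding coord_polynomial_def
  by (elim exE, rule_tac x = "\<lambda>\<beta>. a \<beta> + aa \<beta>" in exI) (simp add: sum.distrib distrib_right)

lemma coord_polynomial_zero: "coord_polynomial M X D (\<lambda>z. 0)"
  unfolding coord_polynomial_def by (rule exI[of _ "\<lambda>_. 0"]) simp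

lemma coord_polynomial_sum:
  "finite A \<Longrightarrow> (\<And>i. i \<in> A \<Longrightarrow> coord_polynomial M X D (f i)) \<Longrightarrow>
    coord_polynomial M X D (\<lambda>z. \<Sum>i\<in>A. f i z)"
  by (induction A rule: finite_induct) (auto intro: coord_polynomial_add coord_polynomial_zero)

lemma coord_polynomial_const:
  "finite M \<Longrightarrow> coord_polynomial M X D (\<lambda>z. c)"
  using coord_polynomial_monomial[of M "\<lambda>_. 0" D X c] by simp

lemma coord_polynomial_coord:
  assumes "finite M" "m \<in> M" "D \<ge> 1"
  shows "coord_polynomial M X D (X m)"
proof -
  have "(\<Prod>k\<in>M. X k z ^ (if k = m then 1 else 0)) = X m z" for z
    using assms by (simp add: if_distrib[of "\<lambda>n. _ ^ n"] cong: if_cong)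
  then show ?thesis
    using coord_polynomial_monomial[of M "\<lambda>k. if k = m then 1 else 0" D X 1] assms
    by simp
qed

lemma coord_polynomial_mult:
  assumes "finite M" "coord_polynomial M X D f" "coord_polynomial M X D' g"
  shows "coord_polynomial M X (D + D') (\<lambda>z. f z * g z)"
proof -
  obtain a b where
    f: "\<And>z. f z = (\<Sum>\<beta>\<in>M \<rightarrow>\<^sub>E {..D}. a \<beta> * (\<Prod>m\<in>M. X m z ^ \<beta> m))" and
    g: "\<And>z. g z = (\<Sum>\<beta>\<in>M \<rightarrow>\<^sub>E {..D'}. b \<beta> * (\<Prod>m\<in>M. X m z ^ \<beta> m))"
    using assms by (auto simp: coord_polynomial_def)
  have eq: "f z * g z = (\<Sum>\<beta>\<in>M \<rightarrow>\<^sub>E {..D}. \<Sum>\<gamma>\<in>M \<rightarrow>\<^sub>E {..D'}.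
      (a \<beta> * b \<gamma>) * (\<Prod>m\<in>M. X m z ^ (\<beta> m + \<gamma> m)))" for z
    unfolding f g sum_product
    by (simp add: power_add prod.distrib mult_ac)
  show ?thesis
    unfolding eq using assms(1)
    by (intro coord_polynomial_sum coord_polynomial_monomial)
      (auto simp: finite_PiE intro!: add_mono dest!: PiE_mem)
qed

lemma coord_polynomial_mono:
  assumes "finite M" "coord_polynomial M X D f" "D \<le> D'"
  shows "coord_polynomial M X D' f"
  using coord_polynomial_mult[OF assms(1,2) coord_polynomial_const[OF assms(1), of X "D' - D" 1]]
    assms(3) by simp

lemma coord_polynomial_power:
  "finite M \<Longrightarrow> coord_polynomial M X D f \<Longrightarrow> coord_polynomial M X (k * D) (\<lambda>z. f z ^ k)"
  by (induction k) (auto intro: coord_polynomial_const coord_polynomial_mult)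

lemma coord_polynomial_prod:
  assumes "finite M" "finite A" "\<And>i. i \<in> A \<Longrightarrow> coord_polynomial M X D (f i)"
  shows "coord_polynomial M X (card A * D) (\<lambda>z. \<Prod>i\<in>A. f i z)"
  using assms(2,3)
  by (induction A rule: finite_induct)
    (auto intro: coord_polynomial_const coord_polynomial_mult assms(1))

text \<open>Counting: with exponents up to \<open>L\<close> there are \<open>(L + 1) ^ card V\<close> power products of
  the functions \<open>F v\<close>. They lie in a space spanned by \<open>O(L ^ card M)\<close> monomials in the coordinates,
  so for large \<open>L\<close> they are linearly dependent.\<close>

lemma polynomials_alg_dependent:
  assumes M: "finite M" and V: "finite V" and card: "card M < card V"
    and poly: "\<And>v. v \<in> V \<Longrightarrow> \<exists>D. coord_polynomial M X D (F v)"
  shows "alg_dependent_on V F UNIV"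
proof -
  obtain D0 where D0: "\<And>v. v \<in> V \<Longrightarrow> coord_polynomial M X (D0 v) (F v)"
    using poly by metis
  define D where "D = Suc (Max (D0 ` V))"
  have D: "coord_polynomial M X D (F v)" if "v \<in> V" for v
    using coord_polynomial_mono[OF M D0[OF that]] that V by (simp add: D_def le_Suc_eq)
  \<comment> \<open>A power product with exponents up to \<open>L\<close> has degree at most \<open>k * L\<close> in each coordinate, and
    \<open>L\<close> is chosen such that \<open>(k * (L + 1)) ^ card M\<close> stays below \<open>(L + 1) ^ (card M + 1)\<close>.\<close>
  define k where "k = card V * D"
  define L where "L = k ^ card M"
  define E where "E = V \<rightarrow>\<^sub>E {..L}"
  define B where "B = M \<rightarrow>\<^sub>E {..k * L}"
  have k: "k > 0" using card by (simp add: k_def D_def)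
  have finE: "finite E" and finB: "finite B"
    using V M by (simp_all add: E_def B_def finite_PiE)
  have "coord_polynomial M X (k * L) (\<lambda>z. \<Prod>v\<in>V. F v z ^ \<alpha> v)" if "\<alpha> \<in> E" for \<alpha>
  proof -
    have "coord_polynomial M X (L * D) (\<lambda>z. F v z ^ \<alpha> v)" if v: "v \<in> V" for v
    proof (rule coord_polynomial_mono[OF M coord_polynomial_power[OF M D[OF v]]])
      show "\<alpha> v * D \<le> L * D" using \<open>\<alpha> \<in> E\<close> v by (auto simp: E_def)
    qed
    then show ?thesis
      using coord_polynomial_prod[OF M V, of X "L * D" "\<lambda>v z. F v z ^ \<alpha> v"]
      by (simp add: k_def mult_ac)
  qed
  then have "\<forall>\<alpha>\<in>E. \<exists>a. \<forall>z.
      (\<Prod>v\<in>V. F v z ^ \<alpha> v) = (\<Sum>\<beta>\<in>B. a \<beta> * (\<Prod>m\<in>M. X m z ^ \<beta> m))"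
    by (simp add: coord_polynomial_def B_def)
  from bchoice[OF this] obtain a where a: "\<And>\<alpha> z. \<alpha> \<in> E \<Longrightarrow>
      (\<Prod>v\<in>V. F v z ^ \<alpha> v) = (\<Sum>\<beta>\<in>B. a \<alpha> \<beta> * (\<Prod>m\<in>M. X m z ^ \<beta> m))"
    by blast
  have "card B = (k * L + 1) ^ card M" using M by (simp add: B_def card_PiE)
  also have "\<dots> \<le> (k * (L + 1)) ^ card M" using k by (intro power_mono) auto
  also have "\<dots> = L * (L + 1) ^ card M" by (simp only: power_mult_distrib flip: L_def)
  also have "\<dots> < (L + 1) ^ Suc (card M)" by simp
  also have "\<dots> \<le> (L + 1) ^ card V" using card by (intro power_increasing) auto
  also have "\<dots> = card E" using V by (simp add: E_def card_PiE)
  finally obtain c where c: "\<exists>\<alpha>\<in>E. c \<alpha> \<noteq> 0" "\<And>\<beta>. \<beta> \<in> B \<Longrightarrow> (\<Sum>\<alpha>\<in>E. c \<alpha> * a \<alpha> \<beta>) = 0"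
    using underdetermined_system_nontrivial_solution[OF finB finE, of a] by blast
  define C where "C = {\<alpha>\<in>E. c \<alpha> \<noteq> 0}"
  have "inj_on (\<lambda>\<alpha>. restrict \<alpha> V) C"
    by (auto simp: inj_on_def C_def E_def PiE_restrict)
  then have "nonzero_polynomial V C c"
    using c(1) finE by (auto simp: nonzero_polynomial_def C_def)
  moreover have "polynomial_value V C c (\<lambda>v. F v z) = 0" for z
  proof -
    have "polynomial_value V C c (\<lambda>v. F v z) = (\<Sum>\<alpha>\<in>E. c \<alpha> * (\<Prod>v\<in>V. F v z ^ \<alpha> v))"
      unfolding polynomial_value_def C_def sum.inter_filter[OF finE] by (rule sum.cong) auto
    also have "\<dots> = (\<Sum>\<alpha>\<in>E. \<Sum>\<beta>\<in>B. (c \<alpha> * a \<alpha> \<beta>) * (\<Prod>m\<in>M. X m z ^ \<beta> m))"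
      by (intro sum.cong refl) (simp add: a sum_distrib_left mult_ac)
    also have "\<dots> = (\<Sum>\<beta>\<in>B. (\<Sum>\<alpha>\<in>E. c \<alpha> * a \<alpha> \<beta>) * (\<Prod>m\<in>M. X m z ^ \<beta> m))"
      by (subst sum.swap) (simp add: sum_distrib_right)
    also have "\<dots> = 0" by (simp add: c(2))
    finally show ?thesis .
  qed
  ultimately show ?thesis by (auto simp: alg_dependent_on_def)
qed

section \<open>Gradients, independent constraints and stationarity\<close>

lemma real_polynomial_function_has_gradient:
  fixes f :: "real ^ 'n::finite \<Rightarrow> real"
  assumes "real_polynomial_function f"
  shows "\<exists>G. (\<forall>x. GDERIV f x :> G x) \<and> (\<forall>k. real_polynomial_function (\<lambda>x. G x $ k))"
  using assms
proof (induction f rule: real_polynomial_function.induct)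
  case (linear f)
  have eq: "f y = y \<bullet> adjoint f 1" for y
    using adjoint_works[OF bounded_linear.linear[OF linear], of y 1] by simp
  have "GDERIV f x :> adjoint f 1" for x
    unfolding gderiv_def eq[symmetric] using bounded_linear_imp_has_derivative[OF linear] .
  then show ?case
    by (intro exI[of _ "\<lambda>_. adjoint f 1"]) (simp add: real_polynomial_function.intros)
next
  case (const c)
  then show ?case
    by (intro exI[of _ "\<lambda>_. 0"]) (simp add: GDERIV_const real_polynomial_function.intros)
next
  case (add f g)
  then obtain F G where
    "\<forall>x. GDERIV f x :> F x" "\<forall>k. real_polynomial_function (\<lambda>x. F x $ k)"
    "\<forall>x. GDERIV g x :> G x" "\<forall>k. real_polynomial_function (\<lambda>x. G x $ k)" by blast
  then show ?case
    by (intro exI[of _ "\<lambda>x. F x + G x"]) (simp add: GDERIV_add real_polynomial_function.intros)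
next
  case (mult f g)
  then obtain F G where
    "\<forall>x. GDERIV f x :> F x" "\<forall>k. real_polynomial_function (\<lambda>x. F x $ k)"
    "\<forall>x. GDERIV g x :> G x" "\<forall>k. real_polynomial_function (\<lambda>x. G x $ k)" by blast
  then show ?case using mult.hyps
    by (intro exI[of _ "\<lambda>x. f x *\<^sub>R G x + g x *\<^sub>R F x"])
      (simp add: GDERIV_mult real_polynomial_function.intros)
qed

lemma gradient_eqI:
  assumes "GDERIV f x :> D"
  shows "gradient f x = D"
  unfolding gradient_def
proof (rule the_equality)
  show "GDERIV f x :> D" by (rule assms)
  fix E assume "GDERIV f x :> E"
  then have "(\<lambda>h. h \<bullet> E) = (\<lambda>h. h \<bullet> D)"
    using assms unfolding gderiv_def by (rule has_derivative_unique)
  then have "(E - D) \<bullet> E = (E - D) \<bullet> D" by metis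
  then have "(E - D) \<bullet> (E - D) = 0" by (simp add: inner_diff_right)
  then show "E = D" by simp
qed

lemma
  fixes f :: "real ^ 'n::finite \<Rightarrow> real"
  assumes "real_polynomial_function f"
  shows GDERIV_gradient: "GDERIV f x :> gradient f x"
    and real_polynomial_function_gradient: "real_polynomial_function (\<lambda>x. gradient f x $ k)"
proof -
  obtain G where G: "\<And>x. GDERIV f x :> G x" "\<And>k. real_polynomial_function (\<lambda>x. G x $ k)"
    using real_polynomial_function_has_gradient[OF assms] by blast
  have "gradient f = G" using gradient_eqI[OF G(1)] by blast
  then show "GDERIV f x :> gradient f x" "real_polynomial_function (\<lambda>x. gradient f x $ k)"
    using G by simp_all
qed

lemma continuous_on_gradient:
  fixes f :: "real ^ 'n::finite \<Rightarrow> real"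
  assumes "real_polynomial_function f"
  shows "continuous_on S (gradient f)"
proof -
  have "continuous_on S (\<lambda>x. gradient f x $ k)" for k
    using real_polynomial_function_gradient[OF assms, of k]
    by (auto simp: real_polynomial_function_eq
        intro!: continuous_at_imp_continuous_on continuous_polymonial_function)
  then have "continuous_on S (\<lambda>x. \<chi> k. gradient f x $ k)" by (intro continuous_on_vec_lambda)
  then show ?thesis by simp
qed

text \<open>Linear functionals can be prescribed on independent vectors, and functionals are inner
  products.\<close>

lemma independent_family_prescribed_inner:
  fixes v :: "'l \<Rightarrow> 'a::euclidean_space"
  assumes "independent_family v L"
  shows "\<exists>d. \<forall>l\<in>L. v l \<bullet> d = b l"
proof -
  have inj: "inj_on v L" and ind: "independent (v ` L)"
    using assms by (auto simp: independent_family_def)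
  obtain g :: "'a \<Rightarrow> real" where g: "linear g" "\<forall>x\<in>v ` L. g x = b (the_inv_into L v x)"
    using linear_independent_extend[OF ind, of "\<lambda>x. b (the_inv_into L v x)"] by blast
  have "v l \<bullet> adjoint g 1 = b l" if "l \<in> L" for l
    using g that adjoint_works[OF g(1), of "v l" 1] by (simp add: the_inv_into_f_f[OF inj])
  then show ?thesis by blast
qed

text \<open>Where the gradients of finitely many functions are independent, these functions are part of
  a local coordinate system, so each can be varied while the others are kept fixed. The coordinate
  map below has the identity as derivative at \<open>x0\<close>, and its component along the gradient of
  \<open>f l\<close> at \<open>x0\<close> is \<open>f l\<close> itself.\<close>

lemma independent_gradients_vary_separately:
  fixes f :: "'l \<Rightarrow> 'a::euclidean_space \<Rightarrow> real"
  assumes L: "finite L"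
    and f': "\<And>l x. l \<in> L \<Longrightarrow> GDERIV (f l) x :> f' l x"
    and cont: "\<And>l. l \<in> L \<Longrightarrow> continuous_on UNIV (f' l)"
    and ind: "independent_family (\<lambda>l. f' l x0) L"
  shows "\<exists>N. open N \<and> x0 \<in> N \<and> (\<forall>y\<in>N. \<forall>w\<in>L. \<forall>T. open T \<longrightarrow> y \<in> T \<longrightarrow>
    (\<exists>y'\<in>T \<inter> N. f w y' \<noteq> f w y \<and> (\<forall>l\<in>L - {w}. f l y' = f l y)))"
proof -
  have "\<forall>m. \<exists>d. \<forall>l\<in>L. f' l x0 \<bullet> d = (if l = m then 1 else 0)"
    by (intro allI independent_family_prescribed_inner[OF ind])
  then obtain d where d: "\<And>l m. l \<in> L \<Longrightarrow> f' l x0 \<bullet> d m = (if l = m then 1 else 0)"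
    by metis
  define \<Phi> where "\<Phi> y = y + (\<Sum>l\<in>L. (f l y - y \<bullet> f' l x0) *\<^sub>R d l)" for y
  define \<Phi>' where "\<Phi>' y = id_blinfun +
      (\<Sum>l\<in>L. blinfun_scaleR_left (d l) o\<^sub>L blinfun_inner_left (f' l y - f' l x0))" for y
  have \<Phi>'_apply: "blinfun_apply (\<Phi>' y) h = h + (\<Sum>l\<in>L. (h \<bullet> (f' l y - f' l x0)) *\<^sub>R d l)" for y h
    by (simp add: \<Phi>'_def blinfun.add_left blinfun.sum_left)
  have deriv: "(\<Phi> has_derivative blinfun_apply (\<Phi>' y)) (at y)" for y
    unfolding \<Phi>_def \<Phi>'_apply
    by (auto intro!: derivative_eq_intros f'[unfolded gderiv_def] simp: inner_diff_right)
  have cont': "continuous_on UNIV \<Phi>'"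
    unfolding \<Phi>'_def
    by (intro continuous_intros bounded_bilinear.continuous_on[OF bounded_bilinear_blinfun_compose]
        bounded_linear.continuous_on[OF bounded_linear_blinfun_inner_left] cont)
  have coord: "\<Phi> y \<bullet> f' m x0 = f m y" if "m \<in> L" for m y
  proof -
    have "(\<Sum>l\<in>L. ((f l y - y \<bullet> f' l x0) *\<^sub>R d l) \<bullet> f' m x0)
        = (\<Sum>l\<in>L. if m = l then f l y - y \<bullet> f' l x0 else 0)"
      using d[OF that] by (intro sum.cong) (auto simp: inner_commute)
    then show ?thesis
      using L that by (simp add: \<Phi>_def inner_add_left inner_sum_left)
  qed
  have "id_blinfun o\<^sub>L \<Phi>' x0 = id_blinfun"
    by (rule blinfun_eqI) (simp add: \<Phi>'_apply)
  then obtain N V \<Psi> where N: "open N" "x0 \<in> N" and V: "open V" and hom: "homeomorphism N V \<Phi> \<Psi>"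
    using inverse_function_theorem[OF open_UNIV deriv cont' UNIV_I] by metis
  have "\<exists>y'\<in>T \<inter> N. f w y' \<noteq> f w y \<and> (\<forall>l\<in>L - {w}. f l y' = f l y)"
    if y: "y \<in> N" and w: "w \<in> L" and T: "open T" "y \<in> T" for y w T
  proof -
    have "openin (top_of_set N) (N \<inter> T)" using T by (simp add: openin_open_Int)
    then have "openin (top_of_set V) (\<Phi> ` (N \<inter> T))"
      using hom by (rule homeomorphism_imp_open_map[rotated])
    then have "open (\<Phi> ` (N \<inter> T))" using V openin_open_eq by blast
    moreover have "\<Phi> y \<in> \<Phi> ` (N \<inter> T)" using y T by auto
    ultimately obtain e where e: "e > 0" "ball (\<Phi> y) e \<subseteq> \<Phi> ` (N \<inter> T)"
      by (meson open_contains_ball)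
    define s where "s = e / (2 * (norm (d w) + 1))"
    have s: "s > 0" using e by (simp add: s_def add_nonneg_pos)
    have "norm (s *\<^sub>R d w) < e"
    proof -
      have "norm (s *\<^sub>R d w) = e * (norm (d w) / (2 * (norm (d w) + 1)))"
        using s e(1) by (simp add: s_def)
      also have "\<dots> < e * 1"
      proof (rule mult_strict_left_mono[OF _ e(1)])
        have "norm (d w) < 2 * (norm (d w) + 1)" by (smt (verit) norm_ge_zero)
        then show "norm (d w) / (2 * (norm (d w) + 1)) < 1"
          by (subst divide_less_eq_1_pos) (auto simp: add_nonneg_pos)
      qed
      finally show ?thesis by simp
    qed
    then have "\<Phi> y + s *\<^sub>R d w \<in> ball (\<Phi> y) e" by (simp add: dist_norm)
    then obtain y' where y': "y' \<in> N \<inter> T" "\<Phi> y' = \<Phi> y + s *\<^sub>R d w" using e by auto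
    have "f m y' = f m y + (if m = w then s else 0)" if "m \<in> L" for m
      using coord[OF that, of y'] coord[OF that, of y]
        d[OF that, of w, unfolded inner_commute[of "f' m x0"]]
      by (auto simp: y'(2) inner_add_left)
    then show ?thesis using y'(1) w s by (intro bexI[of _ y']) auto
  qed
  then show ?thesis using N by blast
qed

text \<open>The component of \<open>q\<close> orthogonal to all \<open>v l\<close> vanishes, because its negative is one of the
  directions \<open>d\<close>.\<close>

lemma in_span_family_if_orthogonal:
  fixes v :: "'l \<Rightarrow> 'a::euclidean_space"
  assumes "finite L" and "\<And>d. (\<And>l. l \<in> L \<Longrightarrow> d \<bullet> v l = 0) \<Longrightarrow> 0 \<le> q \<bullet> d"
  shows "\<exists>\<mu>. q = (\<Sum>l\<in>L. \<mu> l *\<^sub>R v l)"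
proof -
  obtain y z where yz: "y \<in> span (v ` L)" "\<And>w. w \<in> span (v ` L) \<Longrightarrow> orthogonal z w" "q = y + z"
    using orthogonal_subspace_decomp_exists[of "v ` L" q] by metis
  have "(- z) \<bullet> v l = 0" if "l \<in> L" for l
    using yz(2)[OF span_base] that by (auto simp: orthogonal_def)
  then have "0 \<le> q \<bullet> (- z)" by (rule assms(2))
  moreover have "y \<bullet> z = 0" using yz(2)[OF yz(1)] by (simp add: orthogonal_def inner_commute)
  ultimately have "z \<bullet> z \<le> 0" by (simp add: yz(3) inner_add_left)
  then have "z = 0" by (metis inner_eq_zero_iff inner_ge_zero order_antisym)
  then have "q \<in> span (v ` L)" using yz by simp
  moreover have "\<exists>\<mu>. x = (\<Sum>l\<in>L. \<mu> l *\<^sub>R v l)" if "x \<in> span (v ` L)" for x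
    using that
  proof (induction rule: span_induct_alt)
    case base
    show ?case by (intro exI[of _ "\<lambda>_. 0"]) simp
  next
    case (step c w x)
    then obtain l \<mu> where l: "l \<in> L" "w = v l" "x = (\<Sum>l\<in>L. \<mu> l *\<^sub>R v l)" by blast
    have "(\<Sum>k\<in>L. (if k = l then c else 0) *\<^sub>R v k) = (\<Sum>k\<in>L. if k = l then c *\<^sub>R v k else 0)"
      by (rule sum.cong) auto
    then have "(\<Sum>k\<in>L. (\<mu> k + (if k = l then c else 0)) *\<^sub>R v k) = x + c *\<^sub>R w"
      using l assms(1) by (simp add: scaleR_add_left sum.distrib)
    then show ?case by (intro exI[of _ "\<lambda>k. \<mu> k + (if k = l then c else 0)"]) (simp add: add.commute)
  qed
  ultimately show ?thesis by blast
qed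

lemma eventually_less_along_descent:
  assumes "GDERIV f x :> D" "u \<bullet> D < 0"
  shows "\<forall>\<^sub>F t in at_right 0. f (x + t *\<^sub>R u) < f x"
proof -
  have "((\<lambda>t. f (x + t *\<^sub>R u)) has_derivative (\<lambda>t. (t *\<^sub>R u) \<bullet> D)) (at 0)"
  proof (rule has_derivative_compose[where f = "\<lambda>t. x + t *\<^sub>R u" and g = f])
    show "((\<lambda>t. x + t *\<^sub>R u) has_derivative (\<lambda>t. t *\<^sub>R u)) (at 0)"
      by (auto intro!: derivative_eq_intros)
    show "(f has_derivative (\<lambda>h. h \<bullet> D)) (at (x + 0 *\<^sub>R u))"
      using assms(1) by (simp add: gderiv_def)
  qed
  then have "DERIV (\<lambda>t. f (x + t *\<^sub>R u)) 0 :> u \<bullet> D"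
    by (simp add: has_field_derivative_def mult_commute_abs)
  from DERIV_neg_dec_right[OF this assms(2)]
  obtain e where e: "e > 0" "\<And>t. t > 0 \<Longrightarrow> t < e \<Longrightarrow> f (x + t *\<^sub>R u) < f x"
    by fastforce
  show ?thesis
    unfolding eventually_at_right_field using e by blast
qed

text \<open>For a direction \<open>u\<close> orthogonal to all active gradients, LICQ provides a direction \<open>d\<close> along
  which the active inequality constraints strictly decrease and the affine constraints are constant.
  The directions \<open>u + s d\<close> with \<open>s > 0\<close> are feasible, so \<open>Q x\<close> has a nonnegative inner product with
  them, and in the limit with \<open>u\<close>.\<close>

lemma SOL_stationary:
  fixes g :: "'i \<Rightarrow> real ^ 'n::finite \<Rightarrow> real" and h :: "'j \<Rightarrow> real ^ 'n \<Rightarrow> real"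
  assumes fin: "finite I" "finite J"
    and g: "\<And>i. i \<in> I \<Longrightarrow> real_polynomial_function (g i)"
    and h: "\<And>j. j \<in> J \<Longrightarrow> affine_function (h j)"
    and licq: "LICQ_on (feasible_set I g J h) I g J h"
    and x: "x \<in> SOL (feasible_set I g J h) Q"
  shows "\<exists>\<mu>. Q x = (\<Sum>l\<in>active_set I g x <+> J. \<mu> l *\<^sub>R gradient (case_sum g h l) x)"
proof (rule in_span_family_if_orthogonal)
  let ?A = "active_set I g x"
  have xK: "x \<in> feasible_set I g J h" using x by (simp add: SOL_def)
  show "finite (?A <+> J)" using fin by (simp add: active_set_def)
  have "(\<lambda>l. gradient (case_sum g h l) x)
      = case_sum (\<lambda>i. gradient (g i) x) (\<lambda>j. gradient (h j) x)"
    by (auto simp: fun_eq_iff split: sum.split)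
  then have ind: "independent_family (\<lambda>l. gradient (case_sum g h l) x) (?A <+> J)"
    using licq xK by (simp add: LICQ_on_def)
  obtain d where d: "\<forall>l\<in>?A <+> J. gradient (case_sum g h l) x \<bullet> d = case_sum (\<lambda>_. -1) (\<lambda>_. 0) l"
    using independent_family_prescribed_inner[OF ind] by blast
  have dg: "d \<bullet> gradient (g i) x = -1" if "i \<in> ?A" for i
    using bspec[OF d InlI[OF that]] by (simp add: inner_commute)
  have dh: "d \<bullet> gradient (h j) x = 0" if "j \<in> J" for j
    using bspec[OF d InrI[OF that]] by (simp add: inner_commute)
  fix u assume u: "\<And>l. l \<in> ?A <+> J \<Longrightarrow> u \<bullet> gradient (case_sum g h l) x = 0"
  have feasible: "0 \<le> Q x \<bullet> (u + s *\<^sub>R d)" if s: "s > 0" for s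
  proof -
    define e where "e = u + s *\<^sub>R d"
    have "\<forall>\<^sub>F t in at_right 0. g i (x + t *\<^sub>R e) \<le> 0" if i: "i \<in> I" for i
    proof (cases "i \<in> ?A")
      case True
      have "e \<bullet> gradient (g i) x < 0"
        using u[OF InlI[OF True]] s by (simp add: e_def inner_add_left dg[OF True])
      from eventually_less_along_descent[OF GDERIV_gradient[OF g[OF i]] this]
      show ?thesis using True by (auto simp: active_set_def elim: eventually_mono)
    next
      case False
      then have "g i x < 0" using i xK by (force simp: active_set_def feasible_set_def)
      moreover have "((\<lambda>t. g i (x + t *\<^sub>R e)) \<longlongrightarrow> g i (x + 0 *\<^sub>R e)) (at_right 0)"
      proof (rule isCont_tendsto_compose[of _ "g i"])
        show "isCont (g i) (x + 0 *\<^sub>R e)"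
          using g[OF i] by (simp add: continuous_polymonial_function flip: real_polynomial_function_eq)
      qed (intro tendsto_intros)
      ultimately have "\<forall>\<^sub>F t in at_right 0. g i (x + t *\<^sub>R e) < 0"
        by (auto dest: order_tendstoD(2))
      then show ?thesis by (auto elim: eventually_mono)
    qed
    then have "\<forall>\<^sub>F t in at_right 0. \<forall>i\<in>I. g i (x + t *\<^sub>R e) \<le> 0"
      using fin(1) by (simp add: eventually_ball_finite)
    moreover have "\<forall>\<^sub>F t :: real in at_right 0. t > 0" by (simp add: eventually_at_right_less)
    ultimately have "\<forall>\<^sub>F t in at_right 0. t > 0 \<and> (\<forall>i\<in>I. g i (x + t *\<^sub>R e) \<le> 0)"
      by eventually_elim auto
    then obtain t :: real where t: "t > 0" "\<forall>i\<in>I. g i (x + t *\<^sub>R e) \<le> 0"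
      using eventually_happens[of _ "at_right (0::real)"] by auto
    have "h j (x + t *\<^sub>R e) = 0" if j: "j \<in> J" for j
    proof -
      obtain a b where ab: "\<And>y. h j y = a \<bullet> y + b" using h[OF j] by (auto simp: affine_function_def)
      have "GDERIV (h j) x :> a"
        unfolding gderiv_def ab
        by (auto intro!: derivative_eq_intros simp: inner_commute)
      then have "gradient (h j) x = a" by (rule gradient_eqI)
      then have "a \<bullet> e = 0"
        using u[OF InrI[OF j]] dh[OF j] by (simp add: e_def inner_add_right inner_commute)
      then show ?thesis using xK j ab[of x] ab[of "x + t *\<^sub>R e"]
        by (simp add: inner_add_right feasible_set_def)
    qed
    then have "x + t *\<^sub>R e \<in> feasible_set I g J h" using t by (simp add: feasible_set_def)
    then have "0 \<le> Q x \<bullet> (x + t *\<^sub>R e - x)" using x by (auto simp: SOL_def)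
    then show ?thesis using t by (simp add: e_def zero_le_mult_iff)
  qed
  have "((\<lambda>s. Q x \<bullet> (u + s *\<^sub>R d)) \<longlongrightarrow> Q x \<bullet> (u + 0 *\<^sub>R d)) (at_right 0)"
    by (intro tendsto_intros)
  then have "0 \<le> Q x \<bullet> (u + 0 *\<^sub>R d)"
  proof (rule tendsto_lowerbound)
    show "\<forall>\<^sub>F s in at_right 0. 0 \<le> Q x \<bullet> (u + s *\<^sub>R d)"
      using feasible by (intro eventually_mono[OF eventually_at_right_less])
  qed simp
  then show "0 \<le> Q x \<bullet> u" by simp
qed

lemma alg_dependent_on_subset:
  "alg_dependent_on V F S \<Longrightarrow> T \<subseteq> S \<Longrightarrow> alg_dependent_on V F T"
  unfolding alg_dependent_on_def by blast

section \<open>The algebraic relation satisfied by stationary points\<close>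

lemma ex_coord_polynomial_add:
  assumes "finite M" "\<exists>D. coord_polynomial M X D f" "\<exists>D. coord_polynomial M X D g"
  shows "\<exists>D. coord_polynomial M X D (\<lambda>z. f z + g z)"
proof -
  obtain D D' where "coord_polynomial M X D f" "coord_polynomial M X D' g" using assms by blast
  then have "coord_polynomial M X (D + D') f" "coord_polynomial M X (D + D') g"
    using coord_polynomial_mono[OF assms(1)] by (meson le_add1 le_add2)+
  then show ?thesis using coord_polynomial_add by blast
qed

lemma ex_coord_polynomial_mult:
  assumes "finite M" "\<exists>D. coord_polynomial M X D f" "\<exists>D. coord_polynomial M X D g"
  shows "\<exists>D. coord_polynomial M X D (\<lambda>z. f z * g z)"
  using assms coord_polynomial_mult by blast

lemma ex_coord_polynomial_sum:
  assumes "finite M" "finite A" "\<And>i. i \<in> A \<Longrightarrow> \<exists>D. coord_polynomial M X D (f i)"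
  shows "\<exists>D. coord_polynomial M X D (\<lambda>z. \<Sum>i\<in>A. f i z)"
  using assms(2,3)
  by (induction A rule: finite_induct)
    (auto intro: coord_polynomial_zero ex_coord_polynomial_add[OF assms(1)])

lemma ex_coord_polynomial_prod:
  assumes "finite M" "finite A" "\<And>i. i \<in> A \<Longrightarrow> \<exists>D. coord_polynomial M X D (f i)"
  shows "\<exists>D. coord_polynomial M X D (\<lambda>z. \<Prod>i\<in>A. f i z)"
  using assms(2,3)
  by (induction A rule: finite_induct)
    (auto intro: coord_polynomial_const[OF assms(1)] ex_coord_polynomial_mult[OF assms(1)])

lemma ex_coord_polynomial_real_polynomial_function:
  fixes f :: "real ^ 'n::finite \<Rightarrow> real"
  assumes f: "real_polynomial_function f" and M: "finite M"
    and p: "\<And>k. \<exists>D. coord_polynomial M X D (\<lambda>z. p z $ k)"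
  shows "\<exists>D. coord_polynomial M X D (\<lambda>z. f (p z))"
  using f
proof (induction f rule: real_polynomial_function.induct)
  case (linear f)
  have eq: "f y = (\<Sum>k\<in>UNIV. f (axis k 1) * y $ k)" for y
  proof -
    have "f y = f (\<Sum>k\<in>UNIV. y $ k *\<^sub>R axis k 1)"
      by (simp add: basis_expansion flip: scalar_mult_eq_scaleR)
    then show ?thesis
      using bounded_linear.linear[OF linear] by (simp add: linear_sum linear_scale mult.commute)
  qed
  have "\<exists>D. coord_polynomial M X D (\<lambda>z. \<Sum>k\<in>UNIV. f (axis k 1) * p z $ k)"
    using coord_polynomial_const[OF M]
    by (intro ex_coord_polynomial_sum ex_coord_polynomial_mult M finite p) blast
  then show ?case by (simp flip: eq)
next
  case (const c)
  then show ?case using coord_polynomial_const[OF M] by blast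
next
  case (add f g)
  then show ?case by (intro ex_coord_polynomial_add M)
next
  case (mult f g)
  then show ?case by (intro ex_coord_polynomial_mult M)
qed

text \<open>The unknowns of the stationarity system are the point \<open>x\<close>, the multipliers \<open>\<mu>\<close> and the
  nonconstant coefficients of \<open>Q\<close>; they can be chosen freely, since the constant coefficients of
  \<open>Q\<close> are then determined by the equation \<open>Q x = (\<Sum>l. \<mu> l *\<^sub>R gradient (f l) x)\<close>. The quantities
  between which a relation is sought are one coordinate of \<open>x\<close>, the values of the constraint functions
  and all coefficients of \<open>Q\<close>, as polynomials in these unknowns.\<close>

datatype ('n, 'l) unknown = Point 'n | Multiplier 'l | Nonconstant 'n "'n \<Rightarrow> nat"

datatype ('n, 'l) quantity = Coordinate | Constraint 'l | Coefficient 'n "'n \<Rightarrow> nat"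

primrec unknown_value :: "('n::finite, 'l) unknown \<Rightarrow>
    (real ^ 'n) \<times> ('l \<Rightarrow> real) \<times> ('n \<Rightarrow> ('n \<Rightarrow> nat) \<Rightarrow> real) \<Rightarrow> real" where
  "unknown_value (Point k) z = fst z $ k"
| "unknown_value (Multiplier l) z = fst (snd z) l"
| "unknown_value (Nonconstant k \<alpha>) z = snd (snd z) k \<alpha>"

primrec quantity_value :: "nat \<Rightarrow> 'l set \<Rightarrow> ('l \<Rightarrow> real ^ 'n \<Rightarrow> real) \<Rightarrow> 'n::finite \<Rightarrow>
    ('n, 'l) quantity \<Rightarrow>
    (real ^ 'n) \<times> ('l \<Rightarrow> real) \<times> ('n \<Rightarrow> ('n \<Rightarrow> nat) \<Rightarrow> real) \<Rightarrow> real" where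
  "quantity_value d L f q Coordinate z = fst z $ q"
| "quantity_value d L f q (Constraint l) z = f l (fst z)"
| "quantity_value d L f q (Coefficient k \<alpha>) z =
    (if \<alpha> = (\<lambda>_. 0)
     then (\<Sum>l\<in>L. fst (snd z) l * gradient (f l) (fst z) $ k)
       + (\<Sum>\<beta>\<in>multi_indices d - {\<lambda>_. 0}. (- 1 * snd (snd z) k \<beta>) * monomial_fun \<beta> (fst z))
     else snd (snd z) k \<alpha>)"

definition coefficient_quantities :: "nat \<Rightarrow> ('n::finite, 'l) quantity set" where
  "coefficient_quantities d = (\<lambda>(k, \<alpha>). Coefficient k \<alpha>) ` (UNIV \<times> multi_indices d)"

lemma Coefficient_in_coefficient_quantities [simp]:
  "Coefficient k \<alpha> \<in> coefficient_quantities d \<longleftrightarrow> \<alpha> \<in> multi_indices d"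
  "Coordinate \<notin> coefficient_quantities d" "Constraint l \<notin> coefficient_quantities d"
  by (auto simp: coefficient_quantities_def)

lemma finite_coefficient_quantities [simp]: "finite (coefficient_quantities d)"
  by (simp add: coefficient_quantities_def finite_multi_indices)

lemma zero_multi_index: "(\<lambda>_. 0) \<in> multi_indices d"
  by (simp add: multi_indices_def)

lemma quantity_cases_in:
  assumes "v \<in> insert Coordinate (Constraint ` L \<union> coefficient_quantities d)"
  obtains "v = Coordinate" | l where "l \<in> L" "v = Constraint l"
    | k \<alpha> where "\<alpha> \<in> multi_indices d" "v = Coefficient k \<alpha>"
  using assms by (auto simp: coefficient_quantities_def)

text \<open>There is one quantity more than there are unknowns: the constraints match the multipliers, the
  constant coefficients match the coordinates of \<open>x\<close>, and one coordinate of \<open>x\<close> is counted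
  again.\<close>

lemma quantities_alg_dependent:
  fixes f :: "'l \<Rightarrow> real ^ 'n::finite \<Rightarrow> real"
  assumes L: "finite L" and f: "\<And>l. l \<in> L \<Longrightarrow> real_polynomial_function (f l)"
  shows "alg_dependent_on (insert Coordinate (Constraint ` L \<union> coefficient_quantities d))
    (quantity_value d L f q) UNIV"
proof -
  let ?D = "multi_indices d :: ('n \<Rightarrow> nat) set"
  let ?D' = "?D - {\<lambda>_. 0}"
  define NC :: "('n, 'l) unknown set" where
    "NC = (\<lambda>(k, \<alpha>). Nonconstant k \<alpha>) ` (UNIV \<times> ?D')"
  define Mul :: "('n, 'l) unknown set" where "Mul = Multiplier ` L"
  define Pt :: "('n, 'l) unknown set" where "Pt = range Point"
  define M where "M = Pt \<union> (Mul \<union> NC)"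
  define V :: "('n, 'l) quantity set" where
    "V = insert Coordinate (Constraint ` L \<union> coefficient_quantities d)"
  have fin: "finite ?D'" "finite NC" by (simp_all add: NC_def finite_multi_indices)
  have finM: "finite M" and finV: "finite V" using L fin by (simp_all add: M_def V_def Mul_def Pt_def)
  have "card NC = CARD('n) * card ?D'"
    unfolding NC_def by (subst card_image) (auto simp: inj_on_def card_cartesian_product)
  moreover have "card (Mul \<union> NC) = card Mul + card NC"
    using L fin by (intro card_Un_disjoint) (auto simp: NC_def Mul_def)
  moreover have "card M = card Pt + card (Mul \<union> NC)"
    unfolding M_def using L fin by (intro card_Un_disjoint) (auto simp: NC_def Mul_def Pt_def)
  moreover have "card Mul = card L" unfolding Mul_def by (rule card_image) (simp add: inj_on_def)
  moreover have "card Pt = CARD('n)" unfolding Pt_def by (rule card_image) (simp add: inj_on_def)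
  ultimately have "card M = card L + CARD('n) * Suc (card ?D')" by simp
  also have "Suc (card ?D') = card ?D"
    using zero_multi_index by (intro card_Suc_Diff1 finite_multi_indices)
  finally have cardM: "card M = card L + CARD('n) * card ?D" .
  have "card (coefficient_quantities d :: ('n, 'l) quantity set) = CARD('n) * card ?D"
    unfolding coefficient_quantities_def
    by (subst card_image) (auto simp: inj_on_def card_cartesian_product)
  moreover have "card (Constraint ` L \<union> coefficient_quantities d :: ('n, 'l) quantity set)
      = card (Constraint ` L :: ('n, 'l) quantity set)
        + card (coefficient_quantities d :: ('n, 'l) quantity set)"
    using L by (intro card_Un_disjoint) auto
  moreover have "card (Constraint ` L :: ('n, 'l) quantity set) = card L"
    by (rule card_image) (simp add: inj_on_def)
  moreover have "card V = Suc (card (Constraint ` L \<union> coefficient_quantities d :: ('n, 'l) quantity set))"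
    unfolding V_def using L by (intro card_insert_disjoint) auto
  ultimately have card: "card M < card V" using cardM by simp
  note M = finM
  have coord: "\<exists>D. coord_polynomial M unknown_value D (unknown_value m)" if "m \<in> M" for m
    using coord_polynomial_coord[OF M that] by blast
  have pt: "\<exists>D. coord_polynomial M unknown_value D (\<lambda>z. fst z $ k)" for k
    using coord[of "Point k"] by (simp add: M_def Mul_def Pt_def unknown_value.simps[abs_def])
  have mult: "\<exists>D. coord_polynomial M unknown_value D (\<lambda>z. fst (snd z) l)" if "l \<in> L" for l
    using coord[of "Multiplier l"] that by (simp add: M_def Mul_def Pt_def unknown_value.simps[abs_def])
  have nonconst: "\<exists>D. coord_polynomial M unknown_value D (\<lambda>z. snd (snd z) k \<alpha>)" if "\<alpha> \<in> ?D'" for k \<alpha>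
    using coord[of "Nonconstant k \<alpha>"] that by (force simp: M_def NC_def unknown_value.simps[abs_def])
  have const: "\<exists>D. coord_polynomial M unknown_value D (\<lambda>z. c)" for c
    using coord_polynomial_const[OF M] by blast
  have "\<exists>D. coord_polynomial M unknown_value D (quantity_value d L f q v)" if "v \<in> V" for v
  proof (rule quantity_cases_in[OF that[unfolded V_def]])
    assume "v = Coordinate"
    then show ?thesis using pt by (simp add: quantity_value.simps[abs_def])
  next
    fix l assume "l \<in> L" "v = Constraint l"
    then show ?thesis
      using ex_coord_polynomial_real_polynomial_function[OF f M pt]
      by (simp add: quantity_value.simps[abs_def])
  next
    fix k \<alpha> assume \<alpha>: "\<alpha> \<in> ?D" "v = Coefficient k \<alpha>"
    show ?thesis
    proof (cases "\<alpha> = (\<lambda>_. 0)")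
      case True
      have "\<exists>D. coord_polynomial M unknown_value D (\<lambda>z. gradient (f l) (fst z) $ k)" if "l \<in> L" for l
        using ex_coord_polynomial_real_polynomial_function
          [OF real_polynomial_function_gradient[OF f[OF that]] M pt] .
      moreover have "\<exists>D. coord_polynomial M unknown_value D (\<lambda>z. monomial_fun \<beta> (fst z))" for \<beta>
      proof -
        have "\<exists>D. coord_polynomial M unknown_value D (\<lambda>z. (fst z $ k) ^ \<beta> k)" for k
          using pt[of k] coord_polynomial_power[OF M] by blast
        then show ?thesis
          unfolding monomial_fun_def by (intro ex_coord_polynomial_prod M finite)
      qed
      ultimately show ?thesis
        unfolding \<alpha>(2) quantity_value.simps[abs_def] True if_True simp_thms
        by (intro ex_coord_polynomial_add ex_coord_polynomial_sum ex_coord_polynomial_mult M L fin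
            mult nonconst const)
    next
      case False
      then show ?thesis using nonconst[of \<alpha> k] \<alpha>
        by (simp add: quantity_value.simps[abs_def])
    qed
  qed
  then show ?thesis
    unfolding V_def[symmetric] by (rule polynomials_alg_dependent[OF finM finV card])
qed

lemma continuous_on_quantity_value:
  fixes f :: "'l \<Rightarrow> real ^ 'n::finite \<Rightarrow> real"
  assumes f: "\<And>l. l \<in> L \<Longrightarrow> real_polynomial_function (f l)"
    and v: "v \<in> insert Coordinate (Constraint ` L \<union> coefficient_quantities d)"
  shows "continuous_on UNIV (\<lambda>x. quantity_value d L f q v (x, \<mu>, a))"
proof (rule quantity_cases_in[OF v])
  assume "v = Coordinate"
  then show ?thesis by (simp add: continuous_on_component)
next
  fix l assume "l \<in> L" "v = Constraint l"
  then show ?thesis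
    using f by (auto simp: real_polynomial_function_eq
        intro!: continuous_at_imp_continuous_on continuous_polymonial_function)
next
  fix k \<alpha> assume v: "v = Coefficient k \<alpha>"
  have grad: "continuous_on UNIV (\<lambda>x. gradient (f l) x $ k)" if "l \<in> L" for l
    by (intro continuous_on_component continuous_on_gradient f that)
  have coord: "continuous_on UNIV (\<lambda>x :: real ^ 'n. x $ i)" for i
    by (intro continuous_on_component continuous_on_id)
  show ?thesis
    unfolding v quantity_value.simps fst_conv snd_conv monomial_fun_def
    by (cases "\<alpha> = (\<lambda>_. 0)") (auto intro!: continuous_intros grad coord)
qed

text \<open>The constraint functions are put to zero one after the other. At a point with independent
  constraint gradients each of them can be varied separately, which supplies the approximating points
  that the division by a constraint function needs.\<close>

lemma stationary_points_alg_dependent: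
  fixes f :: "'l \<Rightarrow> real ^ 'n::finite \<Rightarrow> real"
  assumes L: "finite L" and f: "\<And>l. l \<in> L \<Longrightarrow> real_polynomial_function (f l)"
  shows "alg_dependent_on (insert Coordinate (coefficient_quantities d)) (quantity_value d L f q)
    {(x, \<mu>, a). independent_family (\<lambda>l. gradient (f l) x) L \<and> (\<forall>l\<in>L. f l x = 0)}"
proof -
  \<comment> \<open>The approximating points have to stay in the set under consideration. Hence the elimination
    takes place on the union \<open>U\<close> of all sets within which the constraints vary separately.\<close>
  define varies where "varies N \<longleftrightarrow> (\<forall>y\<in>N. \<forall>w\<in>L. \<forall>T. open T \<longrightarrow> y \<in> T \<longrightarrow>
    (\<exists>y'\<in>T \<inter> N. f w y' \<noteq> f w y \<and> (\<forall>l\<in>L - {w}. f l y' = f l y)))" for N :: "(real ^ 'n) set"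
  define U where "U = \<Union> {N. varies N}"
  have U: "\<exists>y'\<in>T \<inter> U. f w y' \<noteq> f w y \<and> (\<forall>l\<in>L - {w}. f l y' = f l y)"
    if y: "y \<in> U" and w: "w \<in> L" and T: "open T" "y \<in> T" for y w T
  proof -
    obtain N where N: "y \<in> N" "varies N" using y by (auto simp: U_def)
    have "N \<subseteq> U" using N(2) by (auto simp: U_def)
    moreover have "\<exists>y'\<in>T \<inter> N. f w y' \<noteq> f w y \<and> (\<forall>l\<in>L - {w}. f l y' = f l y)"
      using N(2)[unfolded varies_def, rule_format, OF N(1) w T] .
    ultimately show ?thesis by blast
  qed
  let ?V = "\<lambda>L'. insert Coordinate (Constraint ` (L - L') \<union> coefficient_quantities d)"
  let ?F = "quantity_value d L f q"
  let ?S = "\<lambda>L'. {(x, \<mu>, a). x \<in> U \<and> (\<forall>l\<in>L'. f l x = 0)} :: ((real ^ 'n) \<times> ('l \<Rightarrow> real) \<times> _) set"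
  have "alg_dependent_on (?V L') ?F (?S L')" if "finite L'" "L' \<subseteq> L" for L'
    using that
  proof (induction L' rule: finite_induct)
    case empty
    show ?case
      using alg_dependent_on_subset[OF quantities_alg_dependent[OF L f] subset_UNIV] by simp
  next
    case (insert w L')
    have V_eq: "?V L' = insert (Constraint w) (?V (insert w L'))" using insert by auto
    have S_eq: "?S (insert w L') = {z \<in> ?S L'. ?F (Constraint w) z = 0}" by auto
    show ?case
      unfolding S_eq
    proof (rule alg_dependent_on_zero_set)
      show "finite (?V (insert w L'))" using L by simp
      show "Constraint w \<notin> ?V (insert w L')" by auto
      show "alg_dependent_on (insert (Constraint w) (?V (insert w L'))) ?F (?S L')"
        unfolding V_eq[symmetric] using insert.prems by (intro insert.IH) simp
      fix z assume z: "z \<in> ?S L'" "?F (Constraint w) z = 0"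
      obtain x \<mu> a where z_eq: "z = (x, \<mu>, a)" by (cases z)
      have x: "x \<in> U" "\<And>l. l \<in> L' \<Longrightarrow> f l x = 0" "f w x = 0" using z z_eq by auto
      have "\<exists>y. dist y x < inverse (real (Suc n)) \<and> y \<in> U \<and> f w y \<noteq> 0 \<and> (\<forall>l\<in>L'. f l y = 0)" for n
      proof -
        have "\<exists>y\<in>ball x (inverse (real (Suc n))) \<inter> U. f w y \<noteq> f w x \<and> (\<forall>l\<in>L - {w}. f l y = f l x)"
          using insert.prems x by (intro U) auto
        then obtain y where y: "dist y x < inverse (real (Suc n))" "y \<in> U" "f w y \<noteq> f w x"
            "\<forall>l\<in>L - {w}. f l y = f l x"
          by (auto simp: dist_commute)
        moreover have "f l y = 0" if "l \<in> L'" for l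
        proof -
          have "l \<in> L - {w}" using that insert by auto
          then show ?thesis using y x(2)[OF that] by simp
        qed
        ultimately show ?thesis using x(3) by auto
      qed
      then obtain y where y: "\<And>n. dist (y n) x < inverse (real (Suc n))" "\<And>n. y n \<in> U"
          "\<And>n. f w (y n) \<noteq> 0" "\<And>n l. l \<in> L' \<Longrightarrow> f l (y n) = 0"
        by metis
      have "(\<lambda>n. dist (y n) x) \<longlonglongrightarrow> 0"
      proof (rule Lim_null_comparison[OF always_eventually LIMSEQ_inverse_real_of_nat], rule allI)
        show "norm (dist (y n) x) \<le> inverse (real (Suc n))" for n
          by (simp only: real_norm_def abs_of_nonneg zero_le_dist less_imp_le[OF y(1)])
      qed
      then have lim: "y \<longlonglongrightarrow> x" by (rule tendsto_dist_iff[THEN iffD2])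
      have "(\<lambda>n. ?F v (y n, \<mu>, a)) \<longlonglongrightarrow> ?F v (x, \<mu>, a)"
        if "v \<in> insert (Constraint w) (?V (insert w L'))" for v
      proof -
        have "v \<in> insert Coordinate (Constraint ` L \<union> coefficient_quantities d)"
          using that insert.prems by auto
        from continuous_on_quantity_value[OF f this]
        have "continuous_on UNIV (\<lambda>x. ?F v (x, \<mu>, a))" .
        then show ?thesis using lim by (rule continuous_on_tendsto_compose) auto
      qed
      then show "\<exists>s. (\<forall>n. s n \<in> ?S L' \<and> ?F (Constraint w) (s n) \<noteq> 0) \<and>
          (\<forall>v\<in>insert (Constraint w) (?V (insert w L')). (\<lambda>n. ?F v (s n)) \<longlonglongrightarrow> ?F v z)"
        using y(2-4) z_eq by (intro exI[of _ "\<lambda>n. (y n, \<mu>, a)"]) auto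
    qed
  qed
  from this[OF L order_refl]
  have "alg_dependent_on (insert Coordinate (coefficient_quantities d)) ?F (?S L)" by simp
  then show ?thesis
  proof (rule alg_dependent_on_subset)
    have "x \<in> U" if "independent_family (\<lambda>l. gradient (f l) x) L" for x
      using independent_gradients_vary_separately[OF L GDERIV_gradient[OF f]
          continuous_on_gradient[OF f] that]
      unfolding U_def varies_def by blast
    then show "{(x, \<mu>, a). independent_family (\<lambda>l. gradient (f l) x) L \<and> (\<forall>l\<in>L. f l x = 0)} \<subseteq> ?S L"
      by auto
  qed
qed

section \<open>Finiteness for generic coefficients\<close>

primrec coefficient_values ::
    "('n \<Rightarrow> ('n \<Rightarrow> nat) \<Rightarrow> real) \<Rightarrow> ('n, 'l) quantity \<Rightarrow> real" where
  "coefficient_values A Coordinate = 0"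
| "coefficient_values A (Constraint l) = 0"
| "coefficient_values A (Coefficient k \<alpha>) = A k \<alpha>"

text \<open>Sign conditions on the multipliers are left out: the set is then described by polynomial
  equations, and it is still finite for generic \<open>Q\<close>.\<close>

definition stationary_points ::
    "'l set \<Rightarrow> ('l \<Rightarrow> real ^ 'n \<Rightarrow> real) \<Rightarrow> (real ^ 'n::finite \<Rightarrow> real ^ 'n) \<Rightarrow> (real ^ 'n) set" where
  "stationary_points L f Q = {x. independent_family (\<lambda>l. gradient (f l) x) L \<and>
     (\<forall>l\<in>L. f l x = 0) \<and> (\<exists>\<mu>. Q x = (\<Sum>l\<in>L. \<mu> l *\<^sub>R gradient (f l) x))}"

lemma poly_maps_eq_matrix_poly_map:
  "Q \<in> poly_maps d \<Longrightarrow> Q = matrix_poly_map d (coeff_matrix d Q)"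
  using is_coeff_matrix_coeff_matrix by (auto simp: is_coeff_matrix_def)

lemma quantity_value_Coefficient:
  fixes Q :: "real ^ 'n::finite \<Rightarrow> real ^ 'n"
  assumes Q: "Q \<in> poly_maps d" "Q x = (\<Sum>l\<in>L. \<mu> l *\<^sub>R gradient (f l) x)"
  shows "quantity_value d L f q (Coefficient k \<alpha>) (x, \<mu>, coeff_matrix d Q) = coeff_matrix d Q k \<alpha>"
proof -
  let ?A = "coeff_matrix d Q"
  have "(\<Sum>l\<in>L. \<mu> l * gradient (f l) x $ k) = Q x $ k" by (simp add: Q(2))
  also have "\<dots> = (\<Sum>\<alpha>\<in>multi_indices d. ?A k \<alpha> * monomial_fun \<alpha> x)"
    by (subst poly_maps_eq_matrix_poly_map[OF Q(1)]) (simp add: matrix_poly_map_def)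
  also have "\<dots> = ?A k (\<lambda>_. 0)
      + (\<Sum>\<alpha>\<in>multi_indices d - {\<lambda>_. 0}. ?A k \<alpha> * monomial_fun \<alpha> x)"
    by (subst sum.remove[OF finite_multi_indices zero_multi_index]) (simp add: monomial_fun_def)
  finally show ?thesis by (simp add: sum_negf)
qed

text \<open>The relation of the previous section is, for given coefficients of \<open>Q\<close>, a polynomial equation
  for one coordinate of the stationary points. It has finitely many solutions unless the coefficients
  of all powers of the coordinate vanish; one of these coefficients is singled out.\<close>

lemma finitely_many_coordinates_if_nonzero:
  fixes f :: "'l \<Rightarrow> real ^ 'n::finite \<Rightarrow> real"
  assumes L: "finite L" and f: "\<And>l. l \<in> L \<Longrightarrow> real_polynomial_function (f l)"
  shows "\<exists>(C :: (('n, 'l) quantity \<Rightarrow> nat) set) c.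
    nonzero_polynomial (coefficient_quantities d) C c \<and>
    (\<forall>Q\<in>poly_maps d.
      polynomial_value (coefficient_quantities d) C c (coefficient_values (coeff_matrix d Q)) \<noteq> 0 \<longrightarrow>
      finite ((\<lambda>x. x $ q) ` stationary_points L f Q))"
proof -
  let ?W = "coefficient_quantities d :: ('n, 'l) quantity set"
  have "alg_dependent_on (insert Coordinate ?W) (quantity_value d L f q)
      {(x, \<mu>, a). independent_family (\<lambda>l. gradient (f l) x) L \<and> (\<forall>l\<in>L. f l x = 0)}"
    by (rule stationary_points_alg_dependent[OF L f])
  then obtain C c where C: "nonzero_polynomial (insert Coordinate ?W) C c"
    and rel: "\<And>x \<mu> a. independent_family (\<lambda>l. gradient (f l) x) L \<Longrightarrow> \<forall>l\<in>L. f l x = 0 \<Longrightarrow>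
      polynomial_value (insert Coordinate ?W) C c (\<lambda>v. quantity_value d L f q v (x, \<mu>, a)) = 0"
    unfolding alg_dependent_on_def by blast
  obtain \<alpha>0 where \<alpha>0: "\<alpha>0 \<in> C" using C by (auto simp: nonzero_polynomial_def)
  have fin: "finite C" using C by (simp add: nonzero_polynomial_def)
  let ?C = "{\<alpha>\<in>C. \<alpha> Coordinate = \<alpha>0 Coordinate}"
  have "finite ((\<lambda>x. x $ q) ` stationary_points L f Q)"
    if Q: "Q \<in> poly_maps d"
      and nz: "polynomial_value ?W ?C c (coefficient_values (coeff_matrix d Q)) \<noteq> 0" for Q
  proof (rule finite_subset)
    let ?p = "univariate Coordinate ?W C c (coefficient_values (coeff_matrix d Q))"
    have "coeff ?p (\<alpha>0 Coordinate) \<noteq> 0" using nz by (simp add: coeff_univariate[OF fin])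
    then show "finite {t. poly ?p t = 0}" by (intro poly_roots_finite) auto
    have "poly ?p (x $ q) = 0" if xs: "x \<in> stationary_points L f Q" for x
    proof -
      obtain \<mu> where \<mu>: "Q x = (\<Sum>l\<in>L. \<mu> l *\<^sub>R gradient (f l) x)"
        and x: "independent_family (\<lambda>l. gradient (f l) x) L" "\<forall>l\<in>L. f l x = 0"
        using xs unfolding stationary_points_def by blast
      have "poly ?p (x $ q) = polynomial_value (insert Coordinate ?W) C c
          ((coefficient_values (coeff_matrix d Q))(Coordinate := x $ q))"
        by (simp add: poly_univariate)
      also have "\<dots> = polynomial_value (insert Coordinate ?W) C c
          (\<lambda>v. quantity_value d L f q v (x, \<mu>, coeff_matrix d Q))"
      proof (rule polynomial_value_cong)
        fix v assume "v \<in> insert Coordinate ?W"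
        then consider "v = Coordinate" | k \<alpha> where "v = Coefficient k \<alpha>"
          by (auto simp: coefficient_quantities_def)
        then show "((coefficient_values (coeff_matrix d Q))(Coordinate := x $ q)) v
            = quantity_value d L f q v (x, \<mu>, coeff_matrix d Q)"
          by cases (simp_all del: quantity_value.simps(3) add: quantity_value_Coefficient[OF Q \<mu>])
      qed
      also have "\<dots> = 0" using x by (rule rel)
      finally show ?thesis .
    qed
    then show "(\<lambda>x. x $ q) ` stationary_points L f Q \<subseteq> {t. poly ?p t = 0}" by auto
  qed
  then show ?thesis using nonzero_polynomial_coeff[OF C \<alpha>0] by blast
qed

lemma continuous_map_coeff_matrix:
  fixes k :: "'n::finite"
  assumes \<alpha>: "\<alpha> \<in> multi_indices d"
  shows "continuous_map (poly_maps_topology d) euclideanreal (\<lambda>Q. coeff_matrix d Q k \<alpha>)"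
proof -
  interpret Metric_space "poly_maps d :: (real ^ 'n \<Rightarrow> real ^ 'n) set" "poly_maps_dist d"
    by (rule Metric_space_poly_maps)
  have le: "\<bar>coeff_matrix d P k \<alpha> - coeff_matrix d Q k \<alpha>\<bar> \<le> poly_maps_dist d P Q"
    if "P \<in> poly_maps d" "Q \<in> poly_maps d" for P Q
    unfolding poly_maps_dist_eq[OF that]
    using member_le_L2_set[of "UNIV \<times> multi_indices d" "(k, \<alpha>)"
        "\<lambda>(k, \<alpha>). \<bar>coeff_matrix d P k \<alpha> - coeff_matrix d Q k \<alpha>\<bar>"] \<alpha>
    by (simp add: finite_multi_indices L2_set_def case_prod_unfold)
  show ?thesis
    unfolding poly_maps_topology_def mtopology_is_euclidean[symmetric] Met_TC.continuous_map_to_metric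
  proof (intro ballI allI impI)
    fix P and \<epsilon> :: real assume P: "P \<in> topspace mtopology" and \<epsilon>: "\<epsilon> > 0"
    then have "\<forall>Q\<in>mball P \<epsilon>. coeff_matrix d Q k \<alpha> \<in> ball (coeff_matrix d P k \<alpha>) \<epsilon>"
      using le by (fastforce simp: dist_real_def)
    then show "\<exists>U. openin mtopology U \<and> P \<in> U \<and>
        (\<forall>Q\<in>U. coeff_matrix d Q k \<alpha> \<in> Met_TC.mball (coeff_matrix d P k \<alpha>) \<epsilon>)"
      using P \<epsilon> by (intro exI[of _ "mball P \<epsilon>"]) simp
  qed
qed

text \<open>The coefficients depend continuously on the map, which gives openness. They can be changed
  freely, and an arbitrarily small change leads out of the zero set of the polynomial, which gives
  density.\<close>

lemma nonzero_polynomial_open_dense: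
  fixes C :: "(('n::finite, 'l) quantity \<Rightarrow> nat) set"
  assumes C: "nonzero_polynomial (coefficient_quantities d) C c"
  defines "G \<equiv> {Q \<in> poly_maps d. polynomial_value (coefficient_quantities d) C c
    (coefficient_values (coeff_matrix d Q)) \<noteq> 0}"
  shows "openin (poly_maps_topology d) G \<and>
    poly_maps_topology d closure_of G = topspace (poly_maps_topology d)"
proof
  interpret Metric_space "poly_maps d :: (real ^ 'n \<Rightarrow> real ^ 'n) set" "poly_maps_dist d"
    by (rule Metric_space_poly_maps)
  let ?W = "coefficient_quantities d :: ('n, 'l) quantity set"
  let ?val = "\<lambda>Q. polynomial_value ?W C c (coefficient_values (coeff_matrix d Q))"
  have fin: "finite C" using C by (simp add: nonzero_polynomial_def)
  have "continuous_map (poly_maps_topology d) euclideanreal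
      (\<lambda>Q. coefficient_values (coeff_matrix d Q) v)" if v: "v \<in> ?W" for v
  proof -
    obtain k \<alpha> where "v = Coefficient k \<alpha>" "\<alpha> \<in> multi_indices d"
      using v by (auto simp: coefficient_quantities_def)
    then show ?thesis using continuous_map_coeff_matrix by simp
  qed
  then have "continuous_map (poly_maps_topology d) euclideanreal ?val"
    unfolding polynomial_value_def
    by (intro continuous_map_sum fin continuous_map_real_mult continuous_map_prod
        continuous_map_real_pow finite_coefficient_quantities) simp_all
  from openin_continuous_map_preimage[OF this, of "- {0}"]
  show "openin (poly_maps_topology d) G" by (simp add: G_def open_Compl)
  have "\<exists>Q'\<in>G. poly_maps_dist d Q Q' < r" if Q: "Q \<in> poly_maps d" and r: "r > 0" for Q r
  proof -
    define N where "N = card (UNIV \<times> multi_indices d :: ('n \<times> ('n \<Rightarrow> nat)) set)"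
    define \<epsilon> where "\<epsilon> = r / (real N + 1)"
    have \<epsilon>: "\<epsilon> > 0" using r by (simp add: \<epsilon>_def)
    obtain y where y: "\<And>v. v \<in> ?W \<Longrightarrow> \<bar>y v - coefficient_values (coeff_matrix d Q) v\<bar> < \<epsilon>"
        "polynomial_value ?W C c y \<noteq> 0"
      using nonzero_polynomial_nonzero_nearby[OF finite_coefficient_quantities C \<epsilon>] by blast
    define A where "A k \<alpha> = (if \<alpha> \<in> multi_indices d then y (Coefficient k \<alpha>) else 0)" for k \<alpha>
    define Q' where "Q' = matrix_poly_map d A"
    have Q': "Q' \<in> poly_maps d" by (simp add: Q'_def poly_maps_def)
    have A: "coeff_matrix d Q' = A"
      by (rule coeff_matrix_eqI) (simp add: is_coeff_matrix_def Q'_def A_def)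
    have "polynomial_value ?W C c (coefficient_values A) = polynomial_value ?W C c y"
      by (rule polynomial_value_cong) (auto simp: coefficient_quantities_def A_def)
    then have "Q' \<in> G" using y Q' A by (simp add: G_def)
    moreover have "poly_maps_dist d Q Q' < r"
    proof -
      have "poly_maps_dist d Q Q'
          \<le> (\<Sum>(k, \<alpha>)\<in>UNIV \<times> multi_indices d. \<bar>coeff_matrix d Q k \<alpha> - A k \<alpha>\<bar>)"
        unfolding poly_maps_dist_eq[OF Q Q'] A
        using L2_set_le_sum_abs[of "\<lambda>(k, \<alpha>). coeff_matrix d Q k \<alpha> - A k \<alpha>"]
        by (simp add: case_prod_unfold)
      also have "\<dots> \<le> (\<Sum>(k, \<alpha>)\<in>(UNIV :: 'n set) \<times> (multi_indices d :: ('n \<Rightarrow> nat) set). \<epsilon>)"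
        using y(1)[of "Coefficient _ _"]
        by (intro sum_mono) (auto simp: A_def abs_minus_commute intro!: less_imp_le)
      also have "\<dots> = real N * \<epsilon>" by (simp add: N_def case_prod_unfold)
      also have "\<dots> < r" using r by (simp add: \<epsilon>_def field_simps)
      finally show ?thesis .
    qed
    ultimately show ?thesis by blast
  qed
  then have "poly_maps d \<subseteq> mtopology closure_of G"
    unfolding metric_closure_of by (auto simp: G_def)
  then show "poly_maps_topology d closure_of G = topspace (poly_maps_topology d)"
    using closure_of_subset_topspace[of "poly_maps_topology d" G]
    by (auto simp: poly_maps_topology_def)
qed

lemma finite_vec_if_finite_coordinates:
  fixes S :: "(real ^ 'n::finite) set"
  assumes "\<And>k. finite ((\<lambda>x. x $ k) ` S)"
  shows "finite S"
proof (rule finite_subset)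
  show "S \<subseteq> vec_lambda ` (UNIV \<rightarrow>\<^sub>E (\<Union>k. (\<lambda>x. x $ k) ` S))"
  proof
    fix x assume "x \<in> S"
    then show "x \<in> vec_lambda ` (UNIV \<rightarrow>\<^sub>E (\<Union>k. (\<lambda>x. x $ k) ` S))"
      by (intro image_eqI[of _ _ "\<lambda>k. x $ k"]) auto
  qed
  show "finite (vec_lambda ` (UNIV \<rightarrow>\<^sub>E (\<Union>k. (\<lambda>x. x $ k) ` S)) :: (real ^ 'n) set)"
    using assms by (intro finite_imageI finite_PiE) auto
qed

lemma generic_in_finite_Inter:
  assumes "finite \<A>" "\<A> \<noteq> {}"
    and "\<And>a. a \<in> \<A> \<Longrightarrow> openin X (G a) \<and> X closure_of (G a) = topspace X"
  shows "generic_in X (\<Inter>a\<in>\<A>. G a)"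
proof -
  define U where "U m = G (from_nat_into \<A> m)" for m
  have "openin X (U m) \<and> X closure_of (U m) = topspace X" for m
    using assms(3) from_nat_into[OF assms(2)] by (simp add: U_def)
  moreover have "(\<Inter>m. U m) = (\<Inter>a\<in>\<A>. G a)"
    using range_from_nat_into[OF assms(2) countable_finite[OF assms(1)]]
    by (auto simp: U_def) (metis rangeE)
  moreover have "(\<Inter>a\<in>\<A>. G a) \<subseteq> topspace X"
    using assms(2,3) openin_subset by blast
  ultimately show ?thesis unfolding generic_in_def by blast
qed

theorem theorem5p2:
  fixes d :: nat
    and I :: "'i set" and J :: "'j set"
    and g :: "'i \<Rightarrow> real ^ 'n::finite \<Rightarrow> real"
    and h :: "'j \<Rightarrow> real ^ 'n \<Rightarrow> real"
    and K :: "(real ^ 'n) set"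
  assumes "d > 0"
    and "finite I" and "finite J"
    and "\<And>i. i \<in> I \<Longrightarrow> real_polynomial_function (g i)"
    and "\<And>i. i \<in> I \<Longrightarrow> convex_on UNIV (g i)"
    and "\<And>j. j \<in> J \<Longrightarrow> affine_function (h j)"
    and "K = feasible_set I g J h"
    and "K \<noteq> {}"
    and "LICQ_on K I g J h"
  shows "\<exists>X. generic_in (poly_maps_topology d) X \<and> finite_valued_on (\<lambda>Q. SOL K Q) X"
proof -
  let ?X = "poly_maps_topology d :: (real ^ 'n \<Rightarrow> real ^ 'n) topology"
  define f where "f = case_sum g h"
  have f: "real_polynomial_function (f l)" if l: "l \<in> A <+> J" and A: "A \<subseteq> I" for A l
  proof (cases l)
    case (Inl i)
    then show ?thesis using assms(4) l A by (auto simp: f_def)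
  next
    case (Inr j)
    then have "affine_function (h j)" using assms(6) l by auto
    then obtain a b where "h j = (\<lambda>x. a \<bullet> x + b)" by (auto simp: affine_function_def)
    moreover have "real_polynomial_function (\<lambda>x. a \<bullet> x + b)"
      by (intro real_polynomial_function.intros(3) real_polynomial_function.intros(1,2)
          bounded_linear_inner_right)
    ultimately show ?thesis using Inr by (simp add: f_def)
  qed
  have "\<exists>G. openin ?X G \<and> ?X closure_of G = topspace ?X \<and>
      (\<forall>Q\<in>G. finite ((\<lambda>x. x $ q) ` stationary_points (A <+> J) f Q))" if A: "A \<subseteq> I" for A q
  proof -
    have fin: "finite (A <+> J)" using assms(2,3) finite_subset[OF A] by simp
    have "\<exists>(C :: (('n, 'i + 'j) quantity \<Rightarrow> nat) set) c.
        nonzero_polynomial (coefficient_quantities d) C c \<and>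
        (\<forall>Q\<in>poly_maps d. polynomial_value (coefficient_quantities d) C c
          (coefficient_values (coeff_matrix d Q)) \<noteq> 0 \<longrightarrow>
          finite ((\<lambda>x. x $ q) ` stationary_points (A <+> J) f Q))"
      by (rule finitely_many_coordinates_if_nonzero[OF fin f[OF _ A]])
    then obtain C :: "(('n, 'i + 'j) quantity \<Rightarrow> nat) set" and c where
      C: "nonzero_polynomial (coefficient_quantities d) C c"
        "\<forall>Q\<in>poly_maps d. polynomial_value (coefficient_quantities d) C c
          (coefficient_values (coeff_matrix d Q)) \<noteq> 0 \<longrightarrow>
          finite ((\<lambda>x. x $ q) ` stationary_points (A <+> J) f Q)"
      by blast
    show ?thesis
      by (rule exI[of _ "{Q \<in> poly_maps d. polynomial_value (coefficient_quantities d) C c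
          (coefficient_values (coeff_matrix d Q)) \<noteq> 0}"])
        (use nonzero_polynomial_open_dense[OF C(1)] C(2) in blast)
  qed
  then obtain G where G: "\<And>A q. A \<subseteq> I \<Longrightarrow> openin ?X (G A q) \<and> ?X closure_of (G A q) = topspace ?X"
    and G_fin: "\<And>A q Q. A \<subseteq> I \<Longrightarrow> Q \<in> G A q \<Longrightarrow>
      finite ((\<lambda>x. x $ q) ` stationary_points (A <+> J) f Q)"
    by metis
  define X where "X = (\<Inter>(A, q)\<in>Pow I \<times> (UNIV :: 'n set). G A q)"
  have "generic_in ?X X"
    unfolding X_def using assms(2) G by (intro generic_in_finite_Inter) auto
  moreover have "finite (SOL K Q)" if Q: "Q \<in> X" for Q
  proof (rule finite_subset)
    \<comment> \<open>Solutions with active set \<open>A\<close> are stationary for the equality constraints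
      \<open>A <+> J\<close> alone, and there are finitely many possible active sets.\<close>
    show "SOL K Q \<subseteq> (\<Union>A\<in>Pow I. stationary_points (A <+> J) f Q)"
    proof
      fix x assume x: "x \<in> SOL K Q"
      then have xK: "x \<in> feasible_set I g J h" using assms(7) by (simp add: SOL_def)
      let ?A = "active_set I g x"
      have A: "?A \<subseteq> I" by (auto simp: active_set_def)
      have grads: "(\<lambda>l. gradient (f l) x)
          = case_sum (\<lambda>i. gradient (g i) x) (\<lambda>j. gradient (h j) x)"
        by (auto simp: f_def fun_eq_iff split: sum.split)
      have "independent_family (\<lambda>l. gradient (f l) x) (?A <+> J)"
        unfolding grads using assms(7,9) xK by (simp add: LICQ_on_def)
      moreover have "\<forall>l\<in>?A <+> J. f l x = 0"
        using xK by (auto simp: f_def active_set_def feasible_set_def)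
      moreover have "\<exists>\<mu>. Q x = (\<Sum>l\<in>?A <+> J. \<mu> l *\<^sub>R gradient (f l) x)"
        unfolding f_def
      proof (rule SOL_stationary[OF assms(2,3,4,6)])
        show "LICQ_on (feasible_set I g J h) I g J h" using assms(7,9) by simp
        show "x \<in> SOL (feasible_set I g J h) Q" using assms(7) x by simp
      qed
      ultimately have "x \<in> stationary_points (?A <+> J) f Q" by (simp add: stationary_points_def)
      then show "x \<in> (\<Union>A\<in>Pow I. stationary_points (A <+> J) f Q)" using A by blast
    qed
    have "finite (stationary_points (A <+> J) f Q)" if "A \<subseteq> I" for A
      using Q that by (intro finite_vec_if_finite_coordinates G_fin) (auto simp: X_def)
    then show "finite (\<Union>A\<in>Pow I. stationary_points (A <+> J) f Q)" using assms(2) by auto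
  qed
  ultimately show ?thesis unfolding finite_valued_on_def by blast
qed

end
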